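(* Let $\ell=tp^n+k$ with integers $t\ge 0$, $1\le k\le p^n$, and suppose $\max(r+s-p^{n+1},0)+1\le\ell\le\min(r,s)$ and $\min(R,S)>0$. Assume that $R+S+1\le k\le p^n$ and $t\le\min(r_n-1,s_n-1)$. Then $\lambda_\ell=(r_n+s_n-2t-1)p^n$, so $(g-1)^{(r_n+s_n-2t-2)p^n}$ maps $D_{(r_n+s_n-t)p^n+R+S-k}$ to $D_{(t+2)p^n+R+S-k}$, and the following hold. (1) Define $z_\ell\in D_{(t+2)p^n+R+S-k}$ by \[z_\ell=(-1)^{R}\sum_{i=0}^t(-1)^i(-1)^{k-S-1}v_{(i+1)p^n+R+S+1-k,\,(t-i+1)p^n}.\] Then $(g-1)^{p^n-1}(z_\ell)=x_{(t+1)p^n+R+S+1-k}$. (2) Let $P$ be the $(t+1)\times(t+1)$ matrix over $F$ with $(i,j)$ entry $\binom{r_n+s_n-2t-2}{r_n-t+j-i-1}$ (which is invertible), let $X$ be the $(t+1)\times1$ matrix with $(i,1)$ entry $(-1)^{i-1}$, and let $\zeta=P^{-1}X$. Define $y_\ell\in D_{(r_n+s_n-t)p^n+R+S-k}$ by \[y_\ell=(-1)^{k+R-S-1}\sum_{i=0}^t\zeta_{i+1,1}\,v_{(r_n-t+i)p^n+R+S+1-k,\,(s_n-i)p^n}.\] Then $(g-1)^{(r_n+s_n-2t-2)p^n}(y_\ell)=z_\ell$.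
   Context: $p$ is a prime, $F$ a field of characteristic $p$, $G=\langle g\rangle$ a cyclic group of order $q=p^a$ ($a$ a positive integer). $V_q$ is the indecomposable $FG$-module of dimension $q$, with ordered $F$-basis $(v_1,\dots,v_q)$ such that $gv_1=v_1$ and $gv_i=v_{i-1}+v_i$ for $i>1$; $V_i=\langle v_1,\dots,v_i\rangle$, and $V_1,\dots,V_q$ is a complete set of indecomposable $FG$-modules. Let $1\le r,s\le q$ and write $V_r\otimes V_s\cong V_{\lambda_1}\oplus\dots\oplus V_{\lambda_{\min(r,s)}}$ with $\lambda_1\ge\dots\ge\lambda_{\min(r,s)}>0$. Let $n$ be the unique nonnegative integer with $p^n\le\max(r,s)<p^{n+1}$, and write $r=r_np^n+R$, $s=s_np^n+S$ with integers $0\le r_n,s_n<p$ and $0\le R,S<p^n$ (the paper writes $R_{n-1},S_{n-1}$). The elements $v_{i,j}=v_i\otimes g^{n-i}v_j$ ($1\le i\le r$, $1\le j\le s$) form a basis of $V_r\otimes V_s$ satisfying $(g-1)v_{i,j}=v_{i-1,j}+v_{i,j-1}$, with $v_{i,j}=0$ if $i\le0$ or $j\le0$. Put $D_d=\langle v_{i,j}\mid i+j=d+1\rangle$ for $1\le d\le r+s-1$ and $x_d=\sum_{i=1}^d(-1)^{i-1}v_{i,d+1-i}$ for $1\le d\le\min(r,s)$. Binomial coefficients $\binom cd$ are $0$ if $d<0$ or $d>c$, and are regarded as elements of $F$. *)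

theory Defs
  imports
    "HOL-Algebra.Generated_Groups"
    "HOL-Library.Function_Algebras"
    "Jordan_Normal_Form.Gauss_Jordan_Elimination"
begin

text \<open>
  Vectors are coordinate functions \<open>'i \<Rightarrow> 'f\<close> over the ground field, with pointwise operations.
  A module for the group algebra \<open>FG\<close> is given by its underlying subspace together with the
  action of the group elements; only the values of the action on that subspace matter.
\<close>

definition fscale :: "'f::field \<Rightarrow> ('i \<Rightarrow> 'f) \<Rightarrow> 'i \<Rightarrow> 'f" where
  "fscale c x = (\<lambda>i. c * x i)"

interpretation fsp: vector_space "fscale :: 'f::field \<Rightarrow> ('i \<Rightarrow> 'f) \<Rightarrow> 'i \<Rightarrow> 'f"
  by unfold_locales (auto simp: fscale_def fun_eq_iff algebra_simps)

definition linear_on :: "('i \<Rightarrow> 'f::field) set \<Rightarrow> (('i \<Rightarrow> 'f) \<Rightarrow> 'j \<Rightarrow> 'f) \<Rightarrow> bool" where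
  "linear_on U f \<longleftrightarrow>
     (\<forall>x\<in>U. \<forall>y\<in>U. f (x + y) = f x + f y) \<and> (\<forall>c. \<forall>x\<in>U. f (fscale c x) = fscale c (f x))"

record ('g, 'i, 'f) fgmod =
  fg_space :: "('i \<Rightarrow> 'f) set"
  fg_act :: "'g \<Rightarrow> ('i \<Rightarrow> 'f) \<Rightarrow> 'i \<Rightarrow> 'f"

definition is_fg_module :: "('g, 'm) monoid_scheme \<Rightarrow> ('g, 'i, 'f::field) fgmod \<Rightarrow> bool" where
  "is_fg_module G M \<longleftrightarrow>
     fsp.subspace (fg_space M) \<and>
     (\<forall>h\<in>carrier G. fg_act M h ` fg_space M \<subseteq> fg_space M \<and> linear_on (fg_space M) (fg_act M h)) \<and>
     (\<forall>x\<in>fg_space M. fg_act M \<one>\<^bsub>G\<^esub> x = x) \<and>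
     (\<forall>h\<in>carrier G. \<forall>k\<in>carrier G. \<forall>x\<in>fg_space M. fg_act M (h \<otimes>\<^bsub>G\<^esub> k) x = fg_act M h (fg_act M k x))"

definition fg_iso ::
  "('g, 'm) monoid_scheme \<Rightarrow> ('g, 'i, 'f::field) fgmod \<Rightarrow> ('g, 'j, 'f) fgmod \<Rightarrow> bool" where
  "fg_iso G M N \<longleftrightarrow>
     (\<exists>\<phi>. bij_betw \<phi> (fg_space M) (fg_space N) \<and> linear_on (fg_space M) \<phi> \<and>
        (\<forall>h\<in>carrier G. \<forall>x\<in>fg_space M. \<phi> (fg_act M h x) = fg_act N h (\<phi> x)))"

text \<open>External direct sum of \<open>M k\<close>, \<open>k \<in> K\<close>; the \<open>k\<close>-th component of \<open>x\<close> is \<open>\<lambda>i. x (k, i)\<close>.\<close>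

definition fg_direct_sum ::
  "'k set \<Rightarrow> ('k \<Rightarrow> ('g, 'i, 'f::field) fgmod) \<Rightarrow> ('g, 'k \<times> 'i, 'f) fgmod" where
  "fg_direct_sum K M =
     \<lparr>fg_space = {x. finite {k. \<exists>i. x (k, i) \<noteq> 0} \<and>
                  (\<forall>k\<in>K. (\<lambda>i. x (k, i)) \<in> fg_space (M k)) \<and> (\<forall>k i. k \<notin> K \<longrightarrow> x (k, i) = 0)},
      fg_act = (\<lambda>h x (k, i). if k \<in> K then fg_act (M k) h (\<lambda>i. x (k, i)) i else 0)\<rparr>"

text \<open>
  The module \<open>V\<^sub>q\<close> is the coordinate space with ordered basis \<open>bvec 1, \<dots>, bvec q\<close> and a
  \<open>G\<close>-action \<open>\<rho>\<close>; \<open>Vmod \<rho> r\<close> is its submodule \<open>V\<^sub>r\<close> for \<open>r \<le> q\<close>.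
\<close>

definition bvec :: "nat \<Rightarrow> nat \<Rightarrow> 'f::field" where
  "bvec i = (\<lambda>j. if j = i then 1 else 0)"

definition Vmod ::
  "('g \<Rightarrow> (nat \<Rightarrow> 'f::field) \<Rightarrow> nat \<Rightarrow> 'f) \<Rightarrow> nat \<Rightarrow> ('g, nat, 'f) fgmod" where
  "Vmod \<rho> r = \<lparr>fg_space = fsp.span (bvec ` {1..r}), fg_act = \<rho>\<rparr>"

text \<open>
  The tensor product of two spaces of coordinate functions is realised in the functions of two
  variables, \<open>x \<otimes> y\<close> being \<open>(i, j) \<mapsto> x i * y j\<close>.
\<close>

definition ptensor :: "('i \<Rightarrow> 'f::field) \<Rightarrow> ('j \<Rightarrow> 'f) \<Rightarrow> 'i \<times> 'j \<Rightarrow> 'f" where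
  "ptensor x y = (\<lambda>(i, j). x i * y j)"

text \<open>
  \<open>Vtensor \<rho> r s\<close> is \<open>V\<^sub>r \<otimes> V\<^sub>s\<close>. The diagonal action \<open>h (x \<otimes> y) = h x \<otimes> h y\<close> is written as the
  linear extension from the basis \<open>bvec i \<otimes> bvec j\<close>; see \<open>fg_act_Vtensor_ptensor\<close> below.
\<close>

definition Vtensor ::
  "('g \<Rightarrow> (nat \<Rightarrow> 'f::field) \<Rightarrow> nat \<Rightarrow> 'f) \<Rightarrow> nat \<Rightarrow> nat \<Rightarrow> ('g, nat \<times> nat, 'f) fgmod" where
  "Vtensor \<rho> r s =
     \<lparr>fg_space = fsp.span {ptensor x y | x y. x \<in> fg_space (Vmod \<rho> r) \<and> y \<in> fg_space (Vmod \<rho> s)},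
      fg_act = (\<lambda>h T. \<Sum>i\<in>{1..r}. \<Sum>j\<in>{1..s}.
               fscale (T (i, j)) (ptensor (\<rho> h (bvec i)) (\<rho> h (bvec j))))\<rparr>"

lemma sum_fun_apply: "(\<Sum>i\<in>A. F i) j = (\<Sum>i\<in>A. F i j)"
  for F :: "'k \<Rightarrow> 'i \<Rightarrow> 'b::ab_group_add"
  by (induction A rule: infinite_finite_induct) auto

lemma bvec_in_Vmod: "1 \<le> i \<Longrightarrow> i \<le> r \<Longrightarrow> bvec i \<in> fg_space (Vmod \<rho> r)"
  by (auto simp: Vmod_def intro: fsp.span_base)

lemma linear_on_sum:
  assumes "fsp.subspace U" "linear_on U f" "finite A" "\<And>i. i \<in> A \<Longrightarrow> b i \<in> U"
  shows "f (\<Sum>i\<in>A. fscale (c i) (b i)) = (\<Sum>i\<in>A. fscale (c i) (f (b i)))"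
  using assms(3,4)
proof (induction A rule: finite_induct)
  case empty
  have "f (fscale 0 0) = fscale 0 (f 0)"
    using assms(2) fsp.subspace_0[OF assms(1)] unfolding linear_on_def by blast
  then have "f 0 = 0" by (simp only: fsp.scale_zero_left)
  then show ?case by (simp only: sum.empty)
next
  case (insert i A)
  have bi: "b i \<in> U" and bA: "\<And>j. j \<in> A \<Longrightarrow> b j \<in> U"
    using insert.prems by blast+
  have S: "(\<Sum>i\<in>A. fscale (c i) (b i)) \<in> U"
    by (rule fsp.subspace_sum[OF assms(1)], rule fsp.subspace_scale[OF assms(1)], rule bA)
  have "f (fscale (c i) (b i) + (\<Sum>i\<in>A. fscale (c i) (b i))) =
      f (fscale (c i) (b i)) + f (\<Sum>i\<in>A. fscale (c i) (b i))"
    using assms(2) S fsp.subspace_scale[OF assms(1) bi] unfolding linear_on_def by blast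
  also have "f (fscale (c i) (b i)) = fscale (c i) (f (b i))"
    using assms(2) bi unfolding linear_on_def by blast
  also have "f (\<Sum>i\<in>A. fscale (c i) (b i)) = (\<Sum>i\<in>A. fscale (c i) (f (b i)))"
    by (rule insert.IH, rule bA)
  finally have "f (fscale (c i) (b i) + (\<Sum>i\<in>A. fscale (c i) (b i))) =
      fscale (c i) (f (b i)) + (\<Sum>i\<in>A. fscale (c i) (f (b i)))" .
  then show ?case by (simp only: sum.insert[OF insert.hyps])
qed

lemma Vmod_expand:
  assumes "x \<in> fg_space (Vmod \<rho> r)"
  shows "x = (\<Sum>i\<in>{1..r}. fscale (x i) (bvec i))"
proof -
  have "x \<in> fsp.span (bvec ` {1..r})" using assms by (simp add: Vmod_def)
  then have *: "\<forall>j. j \<notin> {1..r} \<longrightarrow> x j = 0"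
    by (induction rule: fsp.span_induct_alt) (auto simp: fscale_def bvec_def)
  show ?thesis
  proof
    fix j
    show "x j = (\<Sum>i\<in>{1..r}. fscale (x i) (bvec i)) j"
      unfolding sum_fun_apply using * by (simp add: fscale_def bvec_def if_distrib cong: if_cong)
  qed
qed

lemma fg_act_Vtensor_ptensor:
  assumes M: "is_fg_module G (Vmod \<rho> q)" and "r \<le> q" "s \<le> q" and h: "h \<in> carrier G"
    and x: "x \<in> fg_space (Vmod \<rho> r)" and y: "y \<in> fg_space (Vmod \<rho> s)"
  shows "fg_act (Vtensor \<rho> r s) h (ptensor x y) = ptensor (\<rho> h x) (\<rho> h y)"
proof -
  have sub: "fsp.subspace (fg_space (Vmod \<rho> q))" and lin: "linear_on (fg_space (Vmod \<rho> q)) (\<rho> h)"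
    using M h by (auto simp: is_fg_module_def Vmod_def)
  have ex: "\<rho> h x = (\<Sum>i\<in>{1..r}. fscale (x i) (\<rho> h (bvec i)))"
    by (subst Vmod_expand[OF x], rule linear_on_sum[OF sub lin])
      (use \<open>r \<le> q\<close> in \<open>auto intro: bvec_in_Vmod\<close>)
  have ey: "\<rho> h y = (\<Sum>j\<in>{1..s}. fscale (y j) (\<rho> h (bvec j)))"
    by (subst Vmod_expand[OF y], rule linear_on_sum[OF sub lin])
      (use \<open>s \<le> q\<close> in \<open>auto intro: bvec_in_Vmod\<close>)
  show ?thesis
  proof
    fix ab :: "nat \<times> nat"
    obtain a b where ab: "ab = (a, b)" by (cases ab)
    have "fg_act (Vtensor \<rho> r s) h (ptensor x y) ab =
        (\<Sum>i\<in>{1..r}. \<Sum>j\<in>{1..s}. (x i * y j) * (\<rho> h (bvec i) a * \<rho> h (bvec j) b))"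
      by (simp add: Vtensor_def sum_fun_apply ab ptensor_def fscale_def)
    also have "\<dots> = (\<Sum>i\<in>{1..r}. x i * \<rho> h (bvec i) a) * (\<Sum>j\<in>{1..s}. y j * \<rho> h (bvec j) b)"
      unfolding sum_product by (intro sum.cong refl) (simp only: ac_simps)
    also have "(\<Sum>i\<in>{1..r}. x i * \<rho> h (bvec i) a) = \<rho> h x a"
      by (subst ex) (simp add: sum_fun_apply fscale_def)
    also have "(\<Sum>j\<in>{1..s}. y j * \<rho> h (bvec j) b) = \<rho> h y b"
      by (subst ey) (simp add: sum_fun_apply fscale_def)
    finally show "fg_act (Vtensor \<rho> r s) h (ptensor x y) ab = ptensor (\<rho> h x) (\<rho> h y) ab"
      by (simp add: ab ptensor_def)
  qed
qed

definition gminus1 :: "('g, 'i, 'f::field) fgmod \<Rightarrow> 'g \<Rightarrow> ('i \<Rightarrow> 'f) \<Rightarrow> 'i \<Rightarrow> 'f" where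
  "gminus1 M g x = fg_act M g x - x"

text \<open>\<open>vten G g \<rho> n i j\<close> is \<open>v\<^sub>i \<otimes> g\<^bsup>n-i\<^esup> v\<^sub>j\<close>; the exponent may be negative.\<close>

definition vten ::
  "('g, 'm) monoid_scheme \<Rightarrow> 'g \<Rightarrow> ('g \<Rightarrow> (nat \<Rightarrow> 'f::field) \<Rightarrow> nat \<Rightarrow> 'f) \<Rightarrow>
     nat \<Rightarrow> nat \<Rightarrow> nat \<Rightarrow> nat \<times> nat \<Rightarrow> 'f" where
  "vten G g \<rho> n i j =
     (if i = 0 \<or> j = 0 then 0
      else ptensor (bvec i) (\<rho> (g [^]\<^bsub>G\<^esub> (int n - int i)) (bvec j)))"

definition Dspace ::
  "('g, 'm) monoid_scheme \<Rightarrow> 'g \<Rightarrow> ('g \<Rightarrow> (nat \<Rightarrow> 'f::field) \<Rightarrow> nat \<Rightarrow> 'f) \<Rightarrow>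
     nat \<Rightarrow> nat \<Rightarrow> nat \<Rightarrow> nat \<Rightarrow> (nat \<times> nat \<Rightarrow> 'f) set" where
  "Dspace G g \<rho> n r s d =
     fsp.span {vten G g \<rho> n i j | i j. 1 \<le> i \<and> i \<le> r \<and> 1 \<le> j \<and> j \<le> s \<and> i + j = d + 1}"

definition xvec ::
  "('g, 'm) monoid_scheme \<Rightarrow> 'g \<Rightarrow> ('g \<Rightarrow> (nat \<Rightarrow> 'f::field) \<Rightarrow> nat \<Rightarrow> 'f) \<Rightarrow>
     nat \<Rightarrow> nat \<Rightarrow> nat \<times> nat \<Rightarrow> 'f" where
  "xvec G g \<rho> n d = (\<Sum>i\<in>{1..d}. fscale ((- 1) ^ (i - 1)) (vten G g \<rho> n i (d + 1 - i)))"

definition fbinom :: "int \<Rightarrow> int \<Rightarrow> 'f::field" where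
  "fbinom c d = (if d < 0 \<or> d > c then 0 else of_nat (nat c choose nat d))"

end

theory Submission
  imports "HOL-Algebra.Multiplicative_Group" Defs "Jordan_Normal_Form.Determinant"
    "HOL-Computational_Algebra.Polynomial"
begin

text \<open>
  In the basis \<open>v\<^sub>i\<^sub>j\<close> the operator \<open>N = g - 1\<close> is \<open>x + y\<close> for two commuting
  nilpotent shifts \<open>x\<close> and \<open>y\<close>. With \<open>Q = p^n\<close>, Frobenius gives \<open>N^Q = x^Q + y^Q\<close> and
  \<open>N^(Q-1) = \<Sum> (-1)^h x^h y^(Q-1-h)\<close>, so (1) and (2) are read off coordinatewise, (2) being the
  linear system with matrix \<open>P\<close>.

  Invertibility of \<open>P\<close> says that \<open>(1+X)^m u(X)\<close> cannot have a long window of zero coefficients; this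
  holds because a nonzero polynomial of degree less than \<open>p\<close> that is divisible by \<open>(1+X)^K\<close> has more
  than \<open>K\<close> terms.

  The kernel of \<open>N\<close> has basis \<open>x\<^sub>1, x\<^sub>2, \<dots>\<close>, and \<open>\<lambda>\<^sub>l = L\<close> is a matter of how much of
  it lies in the images of \<open>N^(L-1)\<close> and \<open>N^L\<close>. The shift \<open>x\<close> commutes with \<open>N\<close> and takes
  \<open>x\<^sub>d\<close> to \<open>- x\<^sub>d\<^sub>-\<^sub>1\<close>, so (1) and (2) with \<open>d = (t+1)Q\<close> put all \<open>x\<^sub>d\<close> with \<open>d \<le> (t+1)Q\<close> into
  the image of \<open>N^(L-1)\<close>. Conversely, for \<open>d > tQ + R + S\<close> the residue class of \<open>R + 1\<close> modulo \<open>Q\<close>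
  supports a functional that kills the image of \<open>N^L\<close> but not \<open>x\<^sub>d\<close>; it comes from the same
  fact on sparse polynomials.
\<close>

subsection \<open>Sparse polynomials in characteristic \<open>p\<close>\<close>

text \<open>A zero row appended to the \<open>N\<close> equations makes the matrix square and
  singular, and a kernel vector of it is the solution. The dimension counts below are made in this
  form.\<close>

lemma homogeneous_system_nontrivial:
  fixes a :: "nat \<Rightarrow> nat \<Rightarrow> 'f::field"
  shows "\<exists>c. (\<exists>d\<le>N. c d \<noteq> 0) \<and> (\<forall>i<N. (\<Sum>d\<le>N. a i d * c d) = 0)"
proof -
  define A where "A = mat (Suc N) (Suc N) (\<lambda>(i, d). if i < N then a i d else 0)"
  have A: "A \<in> carrier_mat (Suc N) (Suc N)"
    by (simp add: A_def)
  have "A = mat\<^sub>r (Suc N) (Suc N) (\<lambda>i. if i = N then 0\<^sub>v (Suc N) else row A i)"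
    by (rule eq_matI) (auto simp: A_def)
  also have "det \<dots> = 0"
    by (rule det_row_0) (auto simp: A_def)
  finally have "det A = 0" .
  then obtain v where v: "v \<in> carrier_vec (Suc N)" "v \<noteq> 0\<^sub>v (Suc N)" "A *\<^sub>v v = 0\<^sub>v (Suc N)"
    using det_0_iff_vec_prod_zero_field[OF A] by auto
  show ?thesis
  proof (intro exI[of _ "\<lambda>d. v $ d"] conjI allI impI)
    show "\<exists>d\<le>N. v $ d \<noteq> 0"
    proof (rule ccontr)
      assume "\<not> ?thesis"
      then have "v = 0\<^sub>v (Suc N)"
        using v(1) by (intro eq_vecI) auto
      with v(2) show False by simp
    qed
    fix i assume i: "i < N"
    have "(A *\<^sub>v v) $ i = (\<Sum>d<Suc N. a i d * v $ d)"
      using i v(1) A by (auto simp: A_def scalar_prod_def atLeast0LessThan intro!: sum.cong)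
    then show "(\<Sum>d\<le>N. a i d * v $ d) = 0"
      using v(3) i by (simp add: lessThan_Suc_atMost)
  qed
qed

lemma power_linear_dvd_pderiv:
  fixes W :: "'f::idom poly"
  assumes "[:1, 1:] ^ Suc K dvd W"
  shows "[:1, 1:] ^ K dvd pderiv W"
proof -
  obtain V where V: "W = [:1, 1:] ^ Suc K * V"
    using assms by (elim dvdE)
  show ?thesis
    unfolding V pderiv_mult pderiv_power_Suc
    by (rule dvd_add, rule dvd_mult2[OF le_imp_power_dvd], simp, rule dvd_mult[OF dvd_mult2],
        rule dvd_smult, rule dvd_refl)
qed

text \<open>This is where the characteristic enters: below degree \<open>p\<close> differentiation kills
  no monomial except the constant one, so it lowers the number of terms by at most one.\<close>

lemma sparse_poly_multiplicity:
  fixes W :: "'f::field poly"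
  assumes "W \<noteq> 0" and "degree W < CHAR('f)" and "[:1, 1:] ^ K dvd W"
  shows "K < card {i. coeff W i \<noteq> 0}"
  using assms
proof (induction "degree W" arbitrary: W K rule: less_induct)
  case less
  have fin: "finite {i. coeff V i \<noteq> 0}" for V :: "'f poly"
    by (rule finite_subset[of _ "{..degree V}"]) (auto intro: le_degree)
  show ?case
  proof (cases "K = 0")
    case True
    have "degree W \<in> {i. coeff W i \<noteq> 0}"
      using less.prems(1) by simp
    then show ?thesis using True fin[of W] by (metis card_gt_0_iff empty_iff)
  next
    case False
    then obtain K' where K: "K = Suc K'" using not0_implies_Suc by blast
    obtain c V where W: "W = pCons c V" by (cases W)
    have V0: "V \<noteq> 0"
    proof
      assume "V = 0"
      with W less.prems(1,3) K have "degree ([:1, 1:] ^ Suc K' :: 'f poly) \<le> 0"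
        using dvd_imp_degree_le[of "[:1, 1:] ^ Suc K'" W] by auto
      then show False by (simp only: degree_linear_power)
    qed
    then have deg: "degree W = Suc (degree V)" using W by simp
    show ?thesis
    proof (cases "c = 0")
      case True
      \<comment> \<open>With \<open>c = 0\<close> the factor \<open>X\<close>, which does not vanish
        at \<open>- 1\<close>, is split off: the degree drops, while the multiplicity of the root
        \<open>- 1\<close> and the number of terms stay the same.\<close>
      have WV: "W = [:0, 1:] * V" using W True by simp
      have "order (- 1) W = order (- 1) [:0, 1 :: 'f:] + order (- 1) V"
        unfolding WV using V0 by (intro order_mult) simp
      also have "order (- 1) [:0, 1 :: 'f:] = 0"
        by (rule order_0I) simp
      finally have dvd: "[:1, 1:] ^ K dvd V"
        using less.prems(1,3) order_divides[of "- 1 :: 'f" K] by simp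
      have "K < card {i. coeff V i \<noteq> 0}"
        by (rule less.hyps[OF _ V0 _ dvd]) (use deg less.prems(2) in auto)
      also have "\<dots> = card (Suc ` {i. coeff V i \<noteq> 0})"
        by (simp add: card_image)
      also have "\<dots> \<le> card {i. coeff W i \<noteq> 0}"
        by (rule card_mono[OF fin]) (auto simp: W)
      finally show ?thesis .
    next
      case False
      \<comment> \<open>With \<open>c \<noteq> 0\<close> differentiation removes exactly the
        constant term, and the multiplicity drops by at most one; the induction hypothesis is used
        for \<open>pderiv W\<close> and \<open>K'\<close>.\<close>
      have char: "of_nat (Suc i) \<noteq> (0 :: 'f)" if "coeff V i \<noteq> 0" for i
      proof -
        have "Suc i < CHAR('f)"
          using le_degree[OF that] deg less.prems(2) by simp
        then show ?thesis
          unfolding of_nat_eq_0_iff_char_dvd by (auto dest: dvd_imp_le)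
      qed
      have cd: "coeff (pderiv W) i = of_nat (Suc i) * coeff V i" for i
        by (simp add: coeff_pderiv W)
      have D0: "pderiv W \<noteq> 0"
      proof
        assume "pderiv W = 0"
        then have "of_nat (Suc (degree V)) * coeff V (degree V) = 0"
          using cd[of "degree V"] by simp
        then show False using char V0 by (metis leading_coeff_neq_0 mult_eq_0_iff)
      qed
      have dle: "degree (pderiv W) \<le> degree V"
        by (rule degree_le) (simp add: cd coeff_eq_0)
      have "K' < card {i. coeff (pderiv W) i \<noteq> 0}"
        by (rule less.hyps[OF _ D0])
          (use deg dle less.prems(2,3) K power_linear_dvd_pderiv in auto)
      also have "\<dots> \<le> card {i. coeff V i \<noteq> 0}"
        by (rule card_mono[OF fin]) (auto simp: cd)
      finally have "Suc K' < Suc (card (Suc ` {i. coeff V i \<noteq> 0}))"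
        by (simp add: card_image)
      also have "\<dots> = card (insert 0 (Suc ` {i. coeff V i \<noteq> 0}))"
        using fin by (subst card_insert_disjoint) auto
      also have "\<dots> \<le> card {i. coeff W i \<noteq> 0}"
        by (rule card_mono[OF fin]) (auto simp: W False)
      finally show ?thesis using K by simp
    qed
  qed
qed

section \<open>Rows \<open>p ^ n\<close> and \<open>p ^ n - 1\<close> of Pascal's triangle in
  characteristic \<open>p\<close>\<close>

lemma coeff_one_plus_X_power:
  "coeff ([:1, 1:] ^ m :: 'f::comm_semiring_1 poly) i = of_nat (m choose i)"
proof (induction m arbitrary: i)
  case 0
  then show ?case by (cases i) auto
next
  case (Suc m)
  show ?case by (cases i) (auto simp: Suc add.commute)
qed

text \<open>Comparison of coefficients in the Frobenius identity
  \<open>(1 + X) ^ (p ^ n) = 1 + X ^ (p ^ n)\<close>.\<close>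

lemma of_nat_choose_CHAR_power:
  assumes "prime CHAR('f::comm_semiring_1)" and "h \<le> CHAR('f) ^ n"
  shows "(of_nat ((CHAR('f) ^ n) choose h) :: 'f) = (if h = 0 \<or> h = CHAR('f) ^ n then 1 else 0)"
proof -
  have "([:1, 1:] :: 'f poly) = 1 + monom 1 1"
    by (simp add: one_pCons monom_altdef)
  then have "([:1, 1:] :: 'f poly) ^ (CHAR('f) ^ n) = 1 + monom 1 (CHAR('f) ^ n)"
    using assms(1) by (simp add: freshmans_dream' monom_power)
  then have "(of_nat ((CHAR('f) ^ n) choose h) :: 'f) = coeff (1 + monom 1 (CHAR('f) ^ n)) h"
    by (simp flip: coeff_one_plus_X_power)
  also have "\<dots> = (if h = 0 \<or> h = CHAR('f) ^ n then 1 else 0)"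
    using assms by (auto simp: coeff_1 prime_gt_0_nat)
  finally show ?thesis .
qed

text \<open>By Pascal's rule neighbouring entries of row \<open>Q - 1\<close> add up to an inner
  entry of row \<open>Q = p ^ n\<close>, which is zero; starting from \<open>1\<close>, the signs
  alternate.\<close>

lemma of_nat_choose_CHAR_power_minus_1:
  assumes "prime CHAR('f::comm_ring_1)" and "h < CHAR('f) ^ n"
  shows "(of_nat ((CHAR('f) ^ n - 1) choose h) :: 'f) = (- 1) ^ h"
  using assms(2)
proof (induction h)
  case 0
  then show ?case by simp
next
  case (Suc h)
  let ?Q = "CHAR('f) ^ n"
  have "Suc (?Q - 1) = ?Q" using Suc.prems by simp
  then have "(?Q choose Suc h) = (?Q - 1 choose h) + (?Q - 1 choose Suc h)"
    by (metis binomial_Suc_Suc)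
  then have "(of_nat (?Q choose Suc h) :: 'f) = of_nat (?Q - 1 choose h) + of_nat (?Q - 1 choose Suc h)"
    by simp
  then have "of_nat (?Q - 1 choose Suc h) = - (of_nat (?Q - 1 choose h) :: 'f)"
    using of_nat_choose_CHAR_power[OF assms(1), of "Suc h" n] Suc.prems by (simp add: eq_neg_iff_add_eq_0 add.commute)
  then show ?case using Suc by simp
qed

text \<open>Taking \<open>h = Q - 1\<close> in the preceding lemma treats odd characteristic and
  characteristic \<open>2\<close>, where \<open>- 1 = 1\<close>, alike.\<close>

lemma minus_one_power_CHAR_power:
  assumes "prime CHAR('f::comm_ring_1)"
  shows "(- 1 :: 'f) ^ (CHAR('f) ^ n) = - 1"
proof -
  have "CHAR('f) ^ n > 0" using assms by (simp add: prime_gt_0_nat)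
  then have "(- 1 :: 'f) ^ (CHAR('f) ^ n) = - ((- 1) ^ (CHAR('f) ^ n - 1))"
    by (metis Suc_diff_1 mult_minus1 power_Suc)
  also have "(- 1 :: 'f) ^ (CHAR('f) ^ n - 1) = of_nat ((CHAR('f) ^ n - 1) choose (CHAR('f) ^ n - 1))"
    using \<open>CHAR('f) ^ n > 0\<close> by (subst of_nat_choose_CHAR_power_minus_1[OF assms]) auto
  finally show ?thesis by simp
qed

section \<open>Windows of zero coefficients, and the matrix \<open>P\<close>\<close>

lemma fbinom_of_nat: "fbinom (int c) (int d) = of_nat (c choose d)"
  by (simp add: fbinom_def binomial_eq_0)

text \<open>Outside the window at most \<open>K\<close> positions are left, too few for a nonzero
  polynomial in which \<open>- 1\<close> has multiplicity at least \<open>K\<close>.\<close>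

lemma binomial_window_zero:
  fixes W :: "'f::field poly"
  assumes "[:1, 1:] ^ K dvd W" and "degree W \<le> N" and "N < CHAR('f)"
    and gap: "\<And>i. A \<le> i \<Longrightarrow> i < A + c \<Longrightarrow> coeff W i = 0"
    and "A + c \<le> Suc N" and "Suc N \<le> K + c"
  shows "W = 0"
proof (rule ccontr)
  assume "W \<noteq> 0"
  then have "K < card {i. coeff W i \<noteq> 0}"
    using assms(1-3) by (intro sparse_poly_multiplicity) auto
  also have "\<dots> \<le> card ({..<A} \<union> {A + c..N})"
  proof (rule card_mono)
    show "{i. coeff W i \<noteq> 0} \<subseteq> {..<A} \<union> {A + c..N}"
    proof
      fix i assume "i \<in> {i. coeff W i \<noteq> 0}"
      then have "i \<le> degree W" "\<not> (A \<le> i \<and> i < A + c)" using gap by (auto intro: le_degree)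
      then show "i \<in> {..<A} \<union> {A + c..N}" using assms(2) by auto
    qed
  qed simp
  also have "\<dots> \<le> card {..<A} + card {A + c..N}"
    by (rule card_Un_le)
  also have "\<dots> \<le> K"
    using assms(5,6) by simp
  finally show False by simp
qed

text \<open>Unlike in \<open>coeff_mult\<close>, the range of summation does not depend on
  \<open>i\<close>; this allows sums to be interchanged and the coefficients to be read as rows of a
  linear system.\<close>

lemma coeff_mult_atMost:
  fixes u v :: "'f::comm_ring_1 poly"
  assumes "degree u \<le> a"
  shows "coeff (u * v) i = (\<Sum>e\<le>a. if e \<le> i then coeff u e * coeff v (i - e) else 0)"
proof -
  have zero: "coeff u e = 0" if "e \<notin> {..a}" for e
    using that assms by (simp add: coeff_eq_0)
  have "(\<Sum>e\<le>a. if e \<le> i then coeff u e * coeff v (i - e) else 0)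
      = (\<Sum>e\<in>{..a} \<inter> {..i}. coeff u e * coeff v (i - e))"
    by (subst sum.inter_restrict) auto
  also have "\<dots> = (\<Sum>e\<le>i. coeff u e * coeff v (i - e))"
  proof (rule sum.mono_neutral_left)
    show "\<forall>e\<in>{..i} - {..a} \<inter> {..i}. coeff u e * coeff v (i - e) = 0"
      by (metis DiffE IntI mult_zero_left zero)
  qed auto
  finally show ?thesis by (simp add: coeff_mult)
qed

text \<open>With \<open>f i\<close> read as the value of a linear functional at
  \<open>X ^ i\<close>, both sides are its value at \<open>u * v\<close>.\<close>

lemma sum_coeff_mult:
  fixes u v :: "'f::comm_ring_1 poly"
  assumes "degree u \<le> a" "degree v \<le> b"
  shows "(\<Sum>e\<le>a. \<Sum>h\<le>b. coeff u e * coeff v h * f (e + h)) = (\<Sum>i\<le>a + b. coeff (u * v) i * f i)"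
proof -
  have inner: "(\<Sum>h\<le>b. coeff u e * coeff v h * f (e + h))
      = (\<Sum>i\<le>a + b. if e \<le> i then coeff u e * coeff v (i - e) * f i else 0)" if "e \<le> a" for e
  proof -
    have "(\<Sum>h\<le>b. coeff u e * coeff v h * f (e + h))
        = (\<Sum>i\<in>(+) e ` {..b}. coeff u e * coeff v (i - e) * f i)"
      by (simp add: sum.reindex)
    also have "\<dots> = (\<Sum>i\<le>a + b. if e \<le> i then coeff u e * coeff v (i - e) * f i else 0)"
    proof (rule sum.mono_neutral_cong_left)
      show "\<forall>i\<in>{..a + b} - (+) e ` {..b}.
          (if e \<le> i then coeff u e * coeff v (i - e) * f i else 0) = 0"
      proof
        fix i assume i: "i \<in> {..a + b} - (+) e ` {..b}"
        have "b < i - e" if "e \<le> i"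
        proof (rule ccontr)
          assume "\<not> b < i - e"
          then have "i \<in> (+) e ` {..b}" using that by (intro image_eqI[of _ _ "i - e"]) auto
          then show False using i by simp
        qed
        then show "(if e \<le> i then coeff u e * coeff v (i - e) * f i else 0) = 0"
          using assms(2) by (auto simp: coeff_eq_0)
      qed
    qed (use that in auto)
    finally show ?thesis .
  qed
  have "(\<Sum>e\<le>a. \<Sum>h\<le>b. coeff u e * coeff v h * f (e + h))
      = (\<Sum>i\<le>a + b. \<Sum>e\<le>a. if e \<le> i then coeff u e * coeff v (i - e) * f i else 0)"
    by (subst sum.swap) (simp add: inner)
  also have "\<dots> = (\<Sum>i\<le>a + b. coeff (u * v) i * f i)"
  proof (rule sum.cong[OF refl])
    fix i
    show "(\<Sum>e\<le>a. if e \<le> i then coeff u e * coeff v (i - e) * f i else 0) = coeff (u * v) i * f i"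
      unfolding coeff_mult_atMost[OF assms(1)] sum_distrib_right by (rule sum.cong) auto
  qed
  finally show ?thesis .
qed

lemma degree_one_plus_X_power_mult:
  fixes u :: "'f::field poly"
  assumes "degree u \<le> t"
  shows "degree ([:1, 1:] ^ m * u) \<le> m + t"
  using degree_mult_le[of "[:1, 1:] ^ m" u] assms degree_linear_power[of "1 :: 'f" m] by simp

text \<open>The window imposes \<open>t\<close> linear conditions on the \<open>t + 1\<close>
  coefficients of \<open>u\<close>, so a nonzero \<open>u\<close> exists. If \<open>- 1\<close> were
  a root of it, the product would contain one more factor \<open>1 + X\<close>, and
  \<open>binomial_window_zero\<close> would make it zero. The coefficients of \<open>u\<close>
  become the weights of a functional in \<open>shift_sum_kernel_image_vanishes\<close>.\<close>

lemma binomial_window_annihilator: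
  assumes "A + B + t + 1 < CHAR('f::field)"
  shows "\<exists>u :: 'f poly. degree u \<le> t \<and> poly u (- 1) \<noteq> 0 \<and>
    (\<forall>i. A + 1 \<le> i \<longrightarrow> i \<le> A + t \<longrightarrow> coeff ([:1, 1:] ^ (A + B + 1) * u) i = 0)"
proof -
  let ?b = "[:1, 1:] ^ (A + B + 1) :: 'f poly"
  obtain c :: "nat \<Rightarrow> 'f" where c: "\<exists>d\<le>t. c d \<noteq> 0"
    "\<And>i. i < t \<Longrightarrow> (\<Sum>d\<le>t. (if d \<le> A + 1 + i then coeff ?b (A + 1 + i - d) else 0) * c d) = 0"
    using homogeneous_system_nontrivial[of t "\<lambda>i d. if d \<le> A + 1 + i then coeff ?b (A + 1 + i - d) else 0"]
    by blast
  define u where "u = (\<Sum>d\<le>t. monom (c d) d)"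
  have cu: "coeff u d = (if d \<le> t then c d else 0)" for d
    by (simp add: u_def coeff_sum)
  have deg: "degree u \<le> t"
    by (rule degree_le) (simp add: cu)
  have u0: "u \<noteq> 0"
    using c(1) cu by (metis coeff_0)
  have gap: "coeff (?b * u) i = 0" if "A + 1 \<le> i" "i \<le> A + t" for i
  proof -
    have i: "i = A + 1 + (i - A - 1)" "i - A - 1 < t" using that by auto
    have "coeff (?b * u) i = (\<Sum>d\<le>t. (if d \<le> i then coeff ?b (i - d) else 0) * c d)"
      unfolding mult.commute[of ?b] coeff_mult_atMost[OF deg]
      by (rule sum.cong) (auto simp: cu)
    then show ?thesis using c(2)[OF i(2)] i(1) by metis
  qed
  have "poly u (- 1) \<noteq> 0"
  proof
    assume "poly u (- 1) = 0"
    then have "[:1, 1:] dvd u"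
      by (simp add: poly_eq_0_iff_dvd)
    then have dvd: "[:1, 1:] ^ (A + B + 2) dvd ?b * u"
      by (metis add_2_eq_Suc' add_Suc_right Suc_eq_plus1 mult_dvd_mono dvd_refl power_Suc2)
    have "?b * u = 0"
      by (rule binomial_window_zero[OF dvd degree_one_plus_X_power_mult[OF deg], of "A + 1" t])
        (use assms gap in auto)
    then show False using u0 by (simp only: mult_eq_0_iff power_eq_0_iff) simp
  qed
  then show ?thesis using deg gap by blast
qed

text \<open>Read backwards, \<open>v\<close> lists the coefficients of a polynomial \<open>u\<close>
  of degree at most \<open>t\<close>, and the \<open>t + 1\<close> equations say that
  \<open>(1 + X) ^ (A + B) * u\<close> has no terms in degrees \<open>A\<close> to
  \<open>A + t\<close>. Only \<open>A + B\<close> positions remain, so the product is zero by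
  \<open>binomial_window_zero\<close>.\<close>

lemma binomial_toeplitz_kernel:
  fixes v :: "nat \<Rightarrow> 'f::field"
  assumes "A + B + t < CHAR('f)"
    and ker: "\<And>i. i \<le> t \<Longrightarrow> (\<Sum>j\<le>t. fbinom (int (A + B)) (int A + int j - int i) * v j) = 0"
    and "j \<le> t"
  shows "v j = 0"
proof -
  let ?b = "[:1, 1:] ^ (A + B) :: 'f poly"
  define u where "u = (\<Sum>d\<le>t. monom (v (t - d)) d)"
  have cu: "coeff u d = (if d \<le> t then v (t - d) else 0)" for d
    by (simp add: u_def coeff_sum)
  have deg: "degree u \<le> t"
    by (rule degree_le) (simp add: cu)
  have gap: "coeff (?b * u) i = 0" if "A \<le> i" "i < A + (t + 1)" for i
  proof -
    \<comment> \<open>Row \<open>i'\<close> of the system is the coefficient of degree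
      \<open>A + t - i'\<close>.\<close>
    define i' where "i' = A + t - i"
    have i': "i' \<le> t" "i + i' = A + t" using that by (auto simp: i'_def)
    have "coeff (?b * u) i = (\<Sum>d\<le>t. if d \<le> i then v (t - d) * coeff ?b (i - d) else 0)"
      unfolding mult.commute[of ?b] coeff_mult_atMost[OF deg]
      by (rule sum.cong) (auto simp: cu)
    also have "\<dots> = (\<Sum>d\<le>t. if t - d \<le> i then v d * coeff ?b (i - (t - d)) else 0)"
      by (rule sum.reindex_bij_witness[of _ "\<lambda>d. t - d" "\<lambda>d. t - d"]) auto
    also have "\<dots> = (\<Sum>d\<le>t. fbinom (int (A + B)) (int A + int d - int i') * v d)"
    proof (rule sum.cong[OF refl])
      fix d assume "d \<in> {..t}"
      then have d: "d \<le> t" by simp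
      show "(if t - d \<le> i then v d * coeff ?b (i - (t - d)) else 0)
          = fbinom (int (A + B)) (int A + int d - int i') * v d"
      proof (cases "t - d \<le> i")
        case True
        have "int A + int d - int i' = int (i - (t - d))" using True d i' by linarith
        then show ?thesis
          using True by (simp only: coeff_one_plus_X_power fbinom_of_nat mult.commute if_True)
      next
        case False
        then have "int A + int d - int i' < 0" using d i' by linarith
        then show ?thesis using False by (simp add: fbinom_def)
      qed
    qed
    also have "\<dots> = 0" by (rule ker[OF i'(1)])
    finally show ?thesis .
  qed
  have dvd: "?b dvd ?b * u" by simp
  have "?b * u = 0"
    by (rule binomial_window_zero[OF dvd degree_one_plus_X_power_mult[OF deg], of A "t + 1"])
      (use assms(1) gap in auto)
  then have "u = 0" by simp
  then have "coeff u (t - j) = 0" by simp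
  then show ?thesis using assms(3) by (simp add: cu)
qed

text \<open>A trivial kernel also makes the option-valued \<open>mat_inverse\<close> return
  \<open>Some\<close>; otherwise \<open>the (mat_inverse M)\<close> would be unspecified.\<close>

lemma mat_inverse_SomeI:
  fixes M :: "'f::field mat"
  assumes M: "M \<in> carrier_mat n n"
    and ker: "\<And>v. v \<in> carrier_vec n \<Longrightarrow> M *\<^sub>v v = 0\<^sub>v n \<Longrightarrow> v = 0\<^sub>v n"
  shows "invertible_mat M" and "\<exists>M'\<in>carrier_mat n n. mat_inverse M = Some M' \<and> M * M' = 1\<^sub>m n"
proof -
  have "det M \<noteq> 0"
    using det_0_iff_vec_prod_zero_field[OF M] ker by blast
  then have "M \<in> Units (ring_mat TYPE('f) n ())"
    by (rule det_non_zero_imp_unit[OF M])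
  then obtain M' where M': "mat_inverse M = Some M'"
    using mat_inverse(1)[OF M, where b = "()"] by (cases "mat_inverse M") auto
  from mat_inverse(2)[OF M this] M M'
  show "\<exists>M'\<in>carrier_mat n n. mat_inverse M = Some M' \<and> M * M' = 1\<^sub>m n" "invertible_mat M"
    by (auto simp: invertible_mat_def inverts_mat_def intro!: exI[of _ M'])
qed

text \<open>The second part is \<open>P * \<zeta> = X\<close> written out by rows, the form in which
  it is compared with the entries of \<open>shift_sum_funpow_grid_fun\<close>.\<close>

lemma binomial_toeplitz_inverse:
  fixes P :: "'f::field mat"
  assumes "A + B + t < CHAR('f)"
    and P: "P = mat (t + 1) (t + 1) (\<lambda>(i, j). fbinom (int (A + B)) (int A + int j - int i))"
  shows "invertible_mat P"
    and "i \<le> t \<Longrightarrow> X \<in> carrier_mat (t + 1) 1 \<Longrightarrow>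
      (\<Sum>j\<le>t. fbinom (int (A + B)) (int A + int j - int i) * (the (mat_inverse P) * X) $$ (j, 0))
        = X $$ (i, 0)"
proof -
  have Pc: "P \<in> carrier_mat (t + 1) (t + 1)" by (simp add: P)
  have ker: "v = 0\<^sub>v (t + 1)" if v: "v \<in> carrier_vec (t + 1)" "P *\<^sub>v v = 0\<^sub>v (t + 1)" for v
  proof (rule eq_vecI)
    fix j assume "j < dim_vec (0\<^sub>v (t + 1) :: 'f vec)"
    then have j: "j \<le> t" by simp
    have "(\<Sum>j\<le>t. fbinom (int (A + B)) (int A + int j - int i) * v $ j) = 0" if "i \<le> t" for i
    proof -
      have "(P *\<^sub>v v) $ i = (\<Sum>j<Suc t. fbinom (int (A + B)) (int A + int j - int i) * v $ j)"
        using that v(1) by (auto simp: P scalar_prod_def atLeast0LessThan intro!: sum.cong)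
      then show ?thesis using v(2) that by (simp add: lessThan_Suc_atMost)
    qed
    then have "v $ j = 0"
      by (rule binomial_toeplitz_kernel[OF assms(1), where v = "($) v", OF _ j])
    then show "v $ j = 0\<^sub>v (t + 1) $ j" using j by simp
  qed (use v in simp)
  show "invertible_mat P"
    by (rule mat_inverse_SomeI(1)[OF Pc ker])
  obtain P' where P': "P' \<in> carrier_mat (t + 1) (t + 1)" "mat_inverse P = Some P'" "P * P' = 1\<^sub>m (t + 1)"
    using mat_inverse_SomeI(2)[OF Pc] ker by blast
  assume i: "i \<le> t" and X: "X \<in> carrier_mat (t + 1) 1"
  have "P * (P' * X) = X"
    using assoc_mult_mat[OF Pc P'(1) X] P'(3) left_mult_one_mat[OF X] by simp
  moreover have "(P * (P' * X)) $$ (i, 0)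
      = (\<Sum>j<Suc t. fbinom (int (A + B)) (int A + int j - int i) * (P' * X) $$ (j, 0))"
    using i X P' by (auto simp: P scalar_prod_def atLeast0LessThan intro!: sum.cong)
  ultimately show "(\<Sum>j\<le>t. fbinom (int (A + B)) (int A + int j - int i) * (the (mat_inverse P) * X) $$ (j, 0))
        = X $$ (i, 0)"
    by (simp add: P'(2) lessThan_Suc_atMost)
qed

subsection \<open>The operator \<open>g - 1\<close> in coordinates\<close>

text \<open>Binomial theorem for the sum of two commuting shifts by \<open>s\<close>. The operator
  \<open>U\<close> stays abstract because the formula is applied both to \<open>shift_sum\<close>
  with \<open>s = 1\<close> and to its \<open>Q\<close>-th power with \<open>s = Q\<close>.\<close>

lemma funpow_step_sum:
  fixes U :: "(nat \<times> nat \<Rightarrow> 'f::comm_semiring_1) \<Rightarrow> nat \<times> nat \<Rightarrow> 'f"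
  assumes U: "\<And>w i j. 1 \<le> i \<Longrightarrow> 1 \<le> j \<Longrightarrow> U w (i, j) = w (i + s, j) + w (i, j + s)"
    and "1 \<le> i" "1 \<le> j"
  shows "(U ^^ m) w (i, j) = (\<Sum>h\<le>m. of_nat (m choose h) * w (i + h * s, j + (m - h) * s))"
  using assms(2,3)
proof (induction m arbitrary: i j)
  case 0
  then show ?case by simp
next
  case (Suc m)
  let ?f = "\<lambda>h. w (i + h * s, j + (Suc m - h) * s)"
  have a: "(U ^^ m) w (i + s, j) = (\<Sum>h\<le>m. of_nat (m choose h) * ?f (Suc h))"
    using Suc.prems by (subst Suc.IH) (auto simp: algebra_simps)
  have b: "(U ^^ m) w (i, j + s) = (\<Sum>h\<le>m. of_nat (m choose h) * ?f h)"
    using Suc.prems by (subst Suc.IH) (auto simp: Suc_diff_le algebra_simps intro!: sum.cong)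
  have "(\<Sum>h\<le>Suc m. of_nat (Suc m choose h) * ?f h)
      = ?f 0 + (\<Sum>h\<le>m. of_nat (m choose h) * ?f (Suc h)) + (\<Sum>h\<le>m. of_nat (m choose Suc h) * ?f (Suc h))"
    by (subst sum.atMost_Suc_shift) (simp add: sum.distrib algebra_simps)
  also have "?f 0 + (\<Sum>h\<le>m. of_nat (m choose h) * ?f (Suc h)) + (\<Sum>h\<le>m. of_nat (m choose Suc h) * ?f (Suc h))
      = (\<Sum>h\<le>m. of_nat (m choose h) * ?f (Suc h)) + (\<Sum>h\<le>Suc m. of_nat (m choose h) * ?f h)"
    by (subst sum.atMost_Suc_shift) (simp add: algebra_simps)
  also have "(\<Sum>h\<le>Suc m. of_nat (m choose h) * ?f h) = (\<Sum>h\<le>m. of_nat (m choose h) * ?f h)"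
    by (simp add: binomial_eq_0)
  finally show ?case
    using Suc.prems by (simp add: U a b)
qed

text \<open>The operator \<open>g - 1\<close> on coordinates with respect to \<open>v_ij\<close>. It
  sends \<open>v_ij\<close> to the sum of its two lower neighbours, so the new coefficient at
  \<open>(i, j)\<close> collects the old ones at \<open>(i + 1, j)\<close> and
  \<open>(i, j + 1)\<close>.\<close>

definition shift_sum :: "(nat \<times> nat \<Rightarrow> 'f::comm_ring_1) \<Rightarrow> nat \<times> nat \<Rightarrow> 'f" where
  "shift_sum w = (\<lambda>(i, j). if 1 \<le> i \<and> 1 \<le> j then w (i + 1, j) + w (i, j + 1) else 0)"

lemma shift_sum_funpow:
  assumes "1 \<le> i" "1 \<le> j"
  shows "(shift_sum ^^ m) w (i, j) = (\<Sum>h\<le>m. of_nat (m choose h) * w (i + h, j + (m - h)))"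
  using funpow_step_sum[where U = shift_sum and s = 1, OF _ assms] by (simp add: shift_sum_def)

lemma shift_sum_funpow_CHAR_power:
  fixes w :: "nat \<times> nat \<Rightarrow> 'f::comm_ring_1"
  assumes "prime CHAR('f)" and "1 \<le> i" "1 \<le> j"
  shows "(shift_sum ^^ (CHAR('f) ^ n)) w (i, j) = w (i + CHAR('f) ^ n, j) + w (i, j + CHAR('f) ^ n)"
proof -
  let ?Q = "CHAR('f) ^ n"
  have Q: "?Q > 0" using assms(1) by (simp add: prime_gt_0_nat)
  have "(shift_sum ^^ ?Q) w (i, j) = (\<Sum>h\<le>?Q. of_nat (?Q choose h) * w (i + h, j + (?Q - h)))"
    by (rule shift_sum_funpow[OF assms(2,3)])
  also have "\<dots> = (\<Sum>h\<in>{0, ?Q}. of_nat (?Q choose h) * w (i + h, j + (?Q - h)))"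
    by (rule sum.mono_neutral_right) (auto simp: of_nat_choose_CHAR_power[OF assms(1)])
  also have "\<dots> = w (i + ?Q, j) + w (i, j + ?Q)"
    using Q by (simp add: add.commute)
  finally show ?thesis .
qed

text \<open>The binomial formula a second time, now for the \<open>Q\<close>-th power of
  \<open>shift_sum\<close> as a sum of two shifts by \<open>Q\<close>.\<close>

lemma shift_sum_funpow_mult_CHAR_power:
  fixes w :: "nat \<times> nat \<Rightarrow> 'f::comm_ring_1"
  assumes "prime CHAR('f)" and "1 \<le> i" "1 \<le> j"
  shows "(shift_sum ^^ (m * CHAR('f) ^ n)) w (i, j)
    = (\<Sum>h\<le>m. of_nat (m choose h) * w (i + h * CHAR('f) ^ n, j + (m - h) * CHAR('f) ^ n))"
  unfolding mult.commute[of m "CHAR('f) ^ n"] funpow_mult[symmetric]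
  by (rule funpow_step_sum[OF shift_sum_funpow_CHAR_power[OF assms(1)] assms(2,3)])

lemma shift_sum_funpow_CHAR_power_minus_1:
  fixes w :: "nat \<times> nat \<Rightarrow> 'f::comm_ring_1"
  assumes "prime CHAR('f)" and "1 \<le> i" "1 \<le> j"
  shows "(shift_sum ^^ (CHAR('f) ^ n - 1)) w (i, j)
    = (\<Sum>h<CHAR('f) ^ n. (- 1) ^ h * w (i + h, j + (CHAR('f) ^ n - 1 - h)))"
proof -
  have "CHAR('f) ^ n > 0" using assms(1) by (simp add: prime_gt_0_nat)
  then have "{..CHAR('f) ^ n - 1} = {..<CHAR('f) ^ n}"
    by (metis Suc_diff_1 lessThan_Suc_atMost)
  then show ?thesis
    unfolding shift_sum_funpow[OF assms(2,3)]
    by (rule sum.cong) (simp_all only: lessThan_iff of_nat_choose_CHAR_power_minus_1[OF assms(1)] diff_diff_left)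
qed

lemma shift_sum_funpow_border:
  assumes "\<And>i j. i = 0 \<or> j = 0 \<Longrightarrow> w (i, j) = 0" and "i = 0 \<or> j = 0"
  shows "(shift_sum ^^ m) w (i, j) = 0"
  using assms by (cases m) (auto simp: shift_sum_def)

text \<open>Neighbours on an antidiagonal are negatives of each other, so a kernel vector is
  determined by its first row, where its coefficients at the \<open>x_d\<close> stand.\<close>

lemma shift_sum_kernel:
  assumes "shift_sum w = 0"
  shows "w (Suc i, Suc j) = (- 1) ^ i * w (1, Suc (i + j))"
proof (induction i arbitrary: j)
  case 0
  then show ?case by simp
next
  case (Suc i)
  have "shift_sum w (Suc i, Suc j) = 0"
    using assms by simp
  then have "w (Suc (Suc i), Suc j) = - w (Suc i, Suc (Suc j))"
    by (simp add: shift_sum_def eq_neg_iff_add_eq_0)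
  then show ?case by (simp add: Suc)
qed

section \<open>Functions supported on the box, and the kernel vectors \<open>x_d\<close>\<close>

definition box_funs :: "nat \<Rightarrow> nat \<Rightarrow> (nat \<times> nat \<Rightarrow> 'f::zero) set" where
  "box_funs r s = {w. \<forall>i j. i \<notin> {1..r} \<or> j \<notin> {1..s} \<longrightarrow> w (i, j) = 0}"

lemma box_funsD: "w \<in> box_funs r s \<Longrightarrow> i \<notin> {1..r} \<or> j \<notin> {1..s} \<Longrightarrow> w (i, j) = 0"
  by (auto simp: box_funs_def)

lemma shift_sum_in_box_funs:
  assumes "w \<in> box_funs r s" shows "shift_sum w \<in> box_funs r s"
  using assms by (auto simp: box_funs_def shift_sum_def)

lemma shift_sum_funpow_in_box_funs: "w \<in> box_funs r s \<Longrightarrow> (shift_sum ^^ m) w \<in> box_funs r s"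
  by (induction m) (auto intro: shift_sum_in_box_funs)

text \<open>On functions supported in a box this is the \<open>h\<close>-th power of the shift in
  the first index. It carries a preimage of one \<open>alt_diag\<close> under a power of
  \<open>shift_sum\<close> to a preimage, up to sign, of any earlier one.\<close>

definition row_shift :: "nat \<Rightarrow> (nat \<times> nat \<Rightarrow> 'f::comm_ring_1) \<Rightarrow> nat \<times> nat \<Rightarrow> 'f" where
  "row_shift h w = (\<lambda>(i, j). if 1 \<le> i then w (i + h, j) else 0)"

lemma row_shift_in_box_funs: "w \<in> box_funs r s \<Longrightarrow> row_shift h w \<in> box_funs r s"
  by (auto simp: box_funs_def row_shift_def)

lemma shift_sum_row_shift: "shift_sum (row_shift h w) = row_shift h (shift_sum w)"
  by (auto simp: shift_sum_def row_shift_def fun_eq_iff)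

lemma shift_sum_funpow_row_shift:
  "(shift_sum ^^ m) (row_shift h w) = row_shift h ((shift_sum ^^ m) w)"
  by (induction m) (auto simp: shift_sum_row_shift)

text \<open>The coordinates of \<open>xvec\<close>. The support lies in \<open>box_funs r s\<close>
  only when \<open>d \<le> min r s\<close>.\<close>

definition alt_diag :: "nat \<Rightarrow> nat \<times> nat \<Rightarrow> 'f::comm_ring_1" where
  "alt_diag d = (\<lambda>(i, j). if 1 \<le> i \<and> 1 \<le> j \<and> i + j = d + 1 then (- 1) ^ (i - 1) else 0)"

lemma row_shift_alt_diag: "row_shift h (alt_diag (d + h)) = (\<lambda>ij. (- 1) ^ h * alt_diag d ij)"
  by (auto simp: row_shift_def alt_diag_def fun_eq_iff add.commute simp flip: power_add)

lemma shift_sum_alt_diag: "shift_sum (alt_diag d) = 0"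
proof
  fix ij :: "nat \<times> nat"
  obtain i j where ij: "ij = (i, j)" by (cases ij)
  show "shift_sum (alt_diag d) ij = 0 ij"
    by (cases i) (auto simp: ij shift_sum_def alt_diag_def)
qed

section \<open>Grid functions: the coordinates of \<open>z\<close> and \<open>y\<close>\<close>

text \<open>The nonzero entry at \<open>e\<close> sits in position \<open>((A + e) Q - c, (B - e) Q)\<close>; the equation for the row
  is written with \<open>c\<close> on the other side to avoid truncated subtraction.\<close>

definition grid_fun ::
  "nat \<Rightarrow> nat \<Rightarrow> nat \<Rightarrow> nat \<Rightarrow> nat \<Rightarrow> (nat \<Rightarrow> 'f::comm_ring_1) \<Rightarrow> nat \<times> nat \<Rightarrow> 'f" where
  "grid_fun Q c t A B f =
     (\<lambda>(i, j). \<Sum>e\<le>t. if i + c = (A + e) * Q \<and> j = (B - e) * Q then f e else 0)"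

lemma grid_fun_eq_0:
  assumes "\<And>e. e \<le> t \<Longrightarrow> \<not> (i + c = (A + e) * Q \<and> j = (B - e) * Q)"
  shows "grid_fun Q c t A B f (i, j) = 0"
  unfolding grid_fun_def prod.case
proof (rule sum.neutral, rule ballI)
  fix e assume "e \<in> {..t}"
  then show "(if i + c = (A + e) * Q \<and> j = (B - e) * Q then f e else 0) = 0"
    by (simp only: assms if_False atMost_iff)
qed

lemma grid_fun_border:
  assumes "c < Q" "1 \<le> A" "t < B" "i = 0 \<or> j = 0"
  shows "grid_fun Q c t A B f (i, j) = 0"
proof -
  have "\<not> (i + c = (A + e) * Q \<and> j = (B - e) * Q)" if "e \<le> t" for e
  proof -
    have "1 * Q \<le> (A + e) * Q" "1 * Q \<le> (B - e) * Q"
      using assms(2,3) that by (intro mult_le_mono1; simp)+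
    then show ?thesis using assms(1,4) by auto
  qed
  then show ?thesis by (rule grid_fun_eq_0)
qed

lemma grid_fun_apply:
  assumes "0 < Q" "e \<le> t" "i + c = (A + e) * Q" "j = (B - e) * Q"
  shows "grid_fun Q c t A B f (i, j) = f e"
proof -
  have "grid_fun Q c t A B f (i, j) = (\<Sum>e'\<le>t. if e' = e then f e' else 0)"
    unfolding grid_fun_def prod.case
    by (rule sum.cong) (use assms(1) in \<open>auto simp: assms(3,4)\<close>)
  then show ?thesis using assms(2) by simp
qed

lemma grid_fun_units:
  assumes "c < Q" "1 \<le> A"
  shows "grid_fun Q c t A B f = (\<lambda>ij. \<Sum>e\<in>{0..t}. if ij = ((A + e) * Q - c, (B - e) * Q) then f e else 0)"
proof
  fix ij :: "nat \<times> nat"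
  obtain i j where ij: "ij = (i, j)" by (cases ij)
  have le: "c \<le> (A + e) * Q" for e
  proof -
    have "1 * Q \<le> (A + e) * Q" using assms(2) by (intro mult_le_mono1) simp
    then show ?thesis using assms(1) by linarith
  qed
  have "i + c = (A + e) * Q \<longleftrightarrow> i = (A + e) * Q - c" for e
  proof
    assume eq: "i + c = (A + e) * Q"
    show "i = (A + e) * Q - c" unfolding eq[symmetric] by simp
  next
    assume eq: "i = (A + e) * Q - c"
    show "i + c = (A + e) * Q" unfolding eq by (rule le_add_diff_inverse2[OF le])
  qed
  then show "grid_fun Q c t A B f ij
      = (\<Sum>e\<in>{0..t}. if ij = ((A + e) * Q - c, (B - e) * Q) then f e else 0)"
    by (simp only: grid_fun_def ij prod.case prod.inject atLeast0AtMost)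
qed

lemma grid_fun_in_box_funs:
  assumes "c < Q" "1 \<le> A" "t < B" "(A + t) * Q \<le> r" "B * Q \<le> s"
  shows "grid_fun Q c t A B f \<in> box_funs r s"
proof -
  have "i \<in> {1..r} \<and> j \<in> {1..s}" if "grid_fun Q c t A B f (i, j) \<noteq> 0" for i j
  proof -
    have "\<exists>e\<le>t. i + c = (A + e) * Q \<and> j = (B - e) * Q"
    proof (rule ccontr)
      assume "\<not> ?thesis"
      then have "grid_fun Q c t A B f (i, j) = 0" by (intro grid_fun_eq_0) simp
      with that show False by simp
    qed
    then obtain e where e: "e \<le> t" "i + c = (A + e) * Q" "j = (B - e) * Q"
      by (elim exE conjE)
    have "(A + e) * Q \<le> (A + t) * Q" "(B - e) * Q \<le> B * Q"
      using e(1) by (intro mult_le_mono1; simp)+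
    then have "i + c \<le> (A + t) * Q" "j \<le> B * Q"
      by (simp_all only: e(2,3))
    then have "i \<le> r" "j \<le> s" using assms(4,5) by linarith+
    moreover have "\<not> (i = 0 \<or> j = 0)"
      using that grid_fun_border[OF assms(1-3)] by blast
    ultimately show ?thesis by simp
  qed
  then show ?thesis unfolding box_funs_def mem_Collect_eq by metis
qed

text \<open>The power \<open>N ^ (Q - 1)\<close> spreads each entry with alternating signs over
  \<open>Q\<close> consecutive positions of an antidiagonal. The stretches of the
  \<open>t + 1\<close> entries tile the support of \<open>alt_diag\<close>, the stretch of
  \<open>e = 0\<close> losing \<open>c\<close> positions at the border, and the factor
  \<open>(- 1) ^ e\<close> makes the signs fit where two stretches meet.\<close>

lemma shift_sum_funpow_grid_fun_alternating:
  fixes Q c t n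
  defines "Q \<equiv> CHAR('f::comm_ring_1) ^ n"
  assumes prime: "prime CHAR('f)" and c: "c < Q"
  shows "(shift_sum ^^ (Q - 1)) (grid_fun Q c t 1 (t + 1) (\<lambda>e. (- 1) ^ c * (- 1) ^ e :: 'f))
    = alt_diag ((t + 1) * Q - c)"
proof
  fix ij :: "nat \<times> nat"
  obtain i j where ij: "ij = (i, j)" by (cases ij)
  let ?f = "\<lambda>e. (- 1) ^ c * (- 1) ^ e :: 'f"
  let ?z = "grid_fun Q c t 1 (t + 1) ?f"
  define d where "d = (t + 1) * Q - c"
  have dQ: "d + c = (t + 1) * Q" using c by (simp add: d_def)
  have Q: "Q > 0" using c by simp
  have mQ: "(- 1 :: 'f) ^ Q = - 1"
    unfolding Q_def by (rule minus_one_power_CHAR_power[OF prime])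
  show "(shift_sum ^^ (Q - 1)) ?z ij = alt_diag ((t + 1) * Q - c) ij"
  proof (cases "1 \<le> i \<and> 1 \<le> j")
    case False
    have "(shift_sum ^^ (Q - 1)) ?z (i, j) = 0"
      by (rule shift_sum_funpow_border, rule grid_fun_border) (use False c in auto)
    then show ?thesis using False by (auto simp: ij alt_diag_def)
  next
    case True
    then have LHS: "(shift_sum ^^ (Q - 1)) ?z (i, j) = (\<Sum>h<Q. (- 1) ^ h * ?z (i + h, j + (Q - 1 - h)))"
      unfolding Q_def using shift_sum_funpow_CHAR_power_minus_1[OF prime] by blast
    show ?thesis
    proof (cases "i + j = d + 1")
      case False
      have "?z (i + h, j + (Q - 1 - h)) = 0" if h: "h < Q" for h
      proof -
        have "\<not> (i + h + c = (1 + e) * Q \<and> j + (Q - 1 - h) = (t + 1 - e) * Q)" if "e \<le> t" for e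
        proof
          assume *: "i + h + c = (1 + e) * Q \<and> j + (Q - 1 - h) = (t + 1 - e) * Q"
          then have "i + j + c + Q - 1 = (1 + e + (t + 1 - e)) * Q"
            using h unfolding distrib_right by linarith
          also have "\<dots> = d + c + Q" using that dQ by simp
          finally show False using False True by linarith
        qed
        then show ?thesis by (rule grid_fun_eq_0)
      qed
      then have "(shift_sum ^^ (Q - 1)) ?z (i, j) = 0"
        unfolding LHS by (intro sum.neutral ballI) simp
      then show ?thesis using False unfolding d_def[symmetric] ij by (simp add: alt_diag_def)
    next
      case diag: True
      \<comment> \<open>Division of \<open>j - 1\<close> by \<open>Q\<close> finds the stretch
        through \<open>(i, j)\<close> and the place in it: only the grid entry
        \<open>e = t - b\<close> contributes, and only for \<open>h = h0\<close>.\<close>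
      define b h0 where "b = (j - 1) div Q" and "h0 = (j - 1) mod Q"
      have j: "j = b * Q + h0 + 1" and h0: "h0 < Q"
        using True Q by (auto simp: b_def h0_def)
      have bt: "b \<le> t"
      proof (rule ccontr)
        assume "\<not> b \<le> t"
        then have "(t + 1) * Q \<le> b * Q" by (intro mult_le_mono1) simp
        then show False using j diag dQ True by simp
      qed
      have tb: "(t + 1) * Q = (t - b + 1) * Q + b * Q"
        using bt by (simp flip: distrib_right)
      have ic: "i + h0 + c = (1 + (t - b)) * Q"
        using diag dQ j tb by simp
      have "?z (i + h, j + (Q - 1 - h)) = 0" if h: "h < Q" "h \<noteq> h0" for h
      proof -
        have "\<not> (i + h + c = (1 + e) * Q \<and> j + (Q - 1 - h) = (t + 1 - e) * Q)" for e
        proof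
          assume *: "i + h + c = (1 + e) * Q \<and> j + (Q - 1 - h) = (t + 1 - e) * Q"
          then have eq: "h + (1 + (t - b)) * Q = h0 + (1 + e) * Q" using ic by simp
          then have "(h + (1 + (t - b)) * Q) mod Q = (h0 + (1 + e) * Q) mod Q" by (rule arg_cong)
          then show False using h h0 by (simp only: mod_mult_self1 mod_less)
        qed
        then show ?thesis by (rule grid_fun_eq_0)
      qed
      then have "(shift_sum ^^ (Q - 1)) ?z (i, j) = (\<Sum>h\<in>{h0}. (- 1) ^ h * ?z (i + h, j + (Q - 1 - h)))"
        unfolding LHS by (intro sum.mono_neutral_right) (use h0 in auto)
      also have "\<dots> = (- 1) ^ h0 * ?f (t - b)"
      proof -
        have "?z (i + h0, j + (Q - 1 - h0)) = ?f (t - b)"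
        proof (rule grid_fun_apply[OF Q])
          show "t - b \<le> t" by simp
          show "i + h0 + c = (1 + (t - b)) * Q" by (rule ic)
          have "j + (Q - 1 - h0) = (b + 1) * Q" using j h0 by simp
          then show "j + (Q - 1 - h0) = (t + 1 - (t - b)) * Q" using bt by simp
        qed
        then show ?thesis by simp
      qed
      also have "\<dots> = (- 1) ^ (i - 1)"
      proof -
        \<comment> \<open>The exponent \<open>i + h0 + c\<close> is \<open>t - b + 1\<close> times
          \<open>Q\<close> by \<open>ic\<close>, and \<open>(- 1) ^ Q = - 1\<close> reduces it to
          \<open>t - b + 1\<close>.\<close>
        have "(- 1 :: 'f) ^ (i - 1) * ((- 1) ^ h0 * (- 1) ^ c * (- 1)) = (- 1) ^ (i + h0 + c)"
          using True by (cases i) (simp_all add: power_add)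
        also have "\<dots> = (- 1) ^ (t - b) * (- 1)"
          unfolding ic mult.commute[of _ Q] power_mult mQ by simp
        finally have eq: "(- 1 :: 'f) ^ (i - 1) * ((- 1) ^ h0 * (- 1) ^ c) = (- 1) ^ (t - b)" by simp
        have sq: "((- 1 :: 'f) ^ h0 * (- 1) ^ c) * ((- 1) ^ h0 * (- 1) ^ c) = 1"
          by (simp flip: power_mult_distrib power_add)
        have "(- 1 :: 'f) ^ h0 * ((- 1) ^ c * (- 1) ^ (t - b))
            = (- 1) ^ (i - 1) * (((- 1) ^ h0 * (- 1) ^ c) * ((- 1) ^ h0 * (- 1) ^ c))"
          unfolding eq[symmetric] by (simp only: mult.assoc mult.commute mult.left_commute)
        then show ?thesis unfolding sq by simp
      qed
      finally show ?thesis
        using True diag unfolding d_def[symmetric] ij by (simp add: alt_diag_def)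
    qed
  qed
qed

text \<open>All steps of \<open>(x^Q + y^Q) ^ (A + B)\<close> are multiples of \<open>Q\<close>, so
  grids go to grids. Passing from entry \<open>e'\<close> to entry \<open>e\<close> takes
  \<open>A + e' - e\<close> steps in the first direction, which accounts for the binomial
  coefficient; the matrix obtained is \<open>P\<close>.\<close>

lemma shift_sum_funpow_grid_fun:
  fixes Q c t n A B and f :: "nat \<Rightarrow> 'f::field"
  defines "Q \<equiv> CHAR('f) ^ n"
  assumes prime: "prime CHAR('f)" and c: "c < Q"
  shows "(shift_sum ^^ ((A + B) * Q)) (grid_fun Q c t (A + 1) (B + t + 1) f)
    = grid_fun Q c t 1 (t + 1) (\<lambda>e. \<Sum>e'\<le>t. fbinom (int (A + B)) (int A + int e' - int e) * f e')"
proof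
  let ?U = "shift_sum ^^ ((A + B) * Q)" and ?y = "grid_fun Q c t (A + 1) (B + t + 1) f"
    and ?g = "\<lambda>e. \<Sum>e'\<le>t. fbinom (int (A + B)) (int A + int e' - int e) * f e'"
  fix ij :: "nat \<times> nat"
  obtain i j where ij: "ij = (i, j)" by (cases ij)
  have Q: "Q > 0" using c by simp
  show "?U ?y ij = grid_fun Q c t 1 (t + 1) ?g ij"
  proof (cases "1 \<le> i \<and> 1 \<le> j")
    case False
    have "?U ?y (i, j) = 0"
      by (rule shift_sum_funpow_border, rule grid_fun_border) (use False c in auto)
    moreover have "grid_fun Q c t 1 (t + 1) ?g (i, j) = 0"
      by (rule grid_fun_border) (use False c in auto)
    ultimately show ?thesis by (simp add: ij)
  next
    case True
    let ?P = "\<lambda>h e'. i + h * Q + c = (A + 1 + e') * Q \<and> j + (A + B - h) * Q = (B + t + 1 - e') * Q"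
    have "?U ?y (i, j) = (\<Sum>h\<le>A + B. of_nat ((A + B) choose h) * ?y (i + h * Q, j + (A + B - h) * Q))"
      unfolding Q_def using True shift_sum_funpow_mult_CHAR_power[OF prime] by blast
    also have "\<dots> = (\<Sum>h\<le>A + B. \<Sum>e'\<le>t. if ?P h e' then of_nat ((A + B) choose h) * f e' else 0)"
      by (simp add: grid_fun_def sum_distrib_left if_distrib cong: if_cong)
    also have "\<dots> = (\<Sum>e'\<le>t. \<Sum>h\<le>A + B. if ?P h e' then of_nat ((A + B) choose h) * f e' else 0)"
      by (rule sum.swap)
    finally have LHS: "?U ?y (i, j) = \<dots>" .
    show ?thesis
    proof (cases "\<exists>e\<le>t. i + c = (1 + e) * Q \<and> j = (t + 1 - e) * Q")
      case ex: True
      then obtain e where e: "e \<le> t" "i + c = (1 + e) * Q" "j = (t + 1 - e) * Q" by blast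
      have P: "?P h e' \<longleftrightarrow> h + e = A + e'" if "h \<le> A + B" "e' \<le> t" for h e'
      proof -
        have "i + h * Q + c = (1 + e + h) * Q" using e(2) by (simp add: distrib_right)
        moreover have "j + (A + B - h) * Q = (t + 1 - e + (A + B - h)) * Q"
          using e(3) by (simp add: distrib_right)
        ultimately have "?P h e' \<longleftrightarrow> 1 + e + h = A + 1 + e' \<and> t + 1 - e + (A + B - h) = B + t + 1 - e'"
          using Q by (simp only: mult_cancel2) simp
        also have "\<dots> \<longleftrightarrow> h + e = A + e'" using that e(1) by auto
        finally show ?thesis .
      qed
      have inner: "(\<Sum>h\<le>A + B. if ?P h e' then of_nat ((A + B) choose h) * f e' else 0)
          = fbinom (int (A + B)) (int A + int e' - int e) * f e'" if e': "e' \<le> t" for e'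
      proof -
        have "(\<Sum>h\<le>A + B. if ?P h e' then of_nat ((A + B) choose h) * f e' else 0)
            = (\<Sum>h\<le>A + B. if h + e = A + e' then of_nat ((A + B) choose h) * f e' else 0)"
          by (intro sum.cong refl if_cong P) (use e' in auto)
        also have "\<dots> = fbinom (int (A + B)) (int A + int e' - int e) * f e'"
        proof (cases "e \<le> A + e' \<and> A + e' - e \<le> A + B")
          case True
          then have "(h + e = A + e') = (h = A + e' - e)" for h by auto
          moreover have "nat (int A + int e' - int e) = A + e' - e" by linarith
          moreover have "nat (int A + int B) = A + B" by linarith
          moreover have "\<not> int (A + B) < int A + int e' - int e" "\<not> int A + int e' - int e < 0"
            using True by linarith+
          ultimately show ?thesis using True by (simp add: fbinom_def)
        next
          case False
          then have "fbinom (int (A + B)) (int A + int e' - int e) = (0 :: 'f)"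
            by (auto simp: fbinom_def)
          moreover have "\<not> h + e = A + e'" if "h \<le> A + B" for h
            using False that by auto
          ultimately show ?thesis by (auto intro!: sum.neutral)
        qed
        finally show ?thesis .
      qed
      have "?U ?y (i, j) = ?g e"
        unfolding LHS by (rule sum.cong) (use inner in auto)
      also have "\<dots> = grid_fun Q c t 1 (t + 1) ?g (i, j)"
        by (rule grid_fun_apply[symmetric, OF Q e])
      finally show ?thesis by (simp only: ij)
    next
      case nex: False
      \<comment> \<open>Positivity of \<open>i\<close> and of \<open>j\<close> confines the index of
        the target to \<open>0, ..., t\<close>, so nothing lands off the target grid.\<close>
      have "\<not> ?P h e'" if "h \<le> A + B" "e' \<le> t" for h e'
      proof
        assume P: "?P h e'"
        have lt: "h * Q < (A + 1 + e') * Q" using P True by linarith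
        then have "h < A + 1 + e'" using mult_less_cancel2 by blast
        then obtain e where e: "A + e' = h + e" by (metis Suc_eq_plus1 add.assoc add.commute less_Suc_eq_le le_Suc_ex)
        have "A + 1 + e' = h + (1 + e)" using e by simp
        then have 1: "i + c = (1 + e) * Q" using P by (simp add: distrib_right)
        have "(A + B - h) * Q < (B + t + 1 - e') * Q" using P True by linarith
        then have *: "A + B - h < B + t + 1 - e'" using mult_less_cancel2 by blast
        then have et: "e \<le> t" using e that by linarith
        have "B + t + 1 - e' = (A + B - h) + (t + 1 - e)" using e et that by linarith
        then have "j = (t + 1 - e) * Q" using P by (simp add: distrib_right)
        then show False using nex 1 et by blast
      qed
      then have "?U ?y (i, j) = 0"
        unfolding LHS by (intro sum.neutral ballI) auto
      moreover have "grid_fun Q c t 1 (t + 1) ?g (i, j) = 0"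
        by (rule grid_fun_eq_0) (use nex in blast)
      ultimately show ?thesis by (simp only: ij)
    qed
  qed
qed

text \<open>A weighted sum of \<open>t + 1\<close> entries of the image on the antidiagonal of
  \<open>d\<close> is evaluated twice. In terms of \<open>u\<close> the weights multiply up to
  \<open>v * (1 + X) ^ (A + B + 1)\<close>: inside the window its coefficients vanish, outside it
  the entries of \<open>u\<close> lie beyond the box. In terms of the kernel property the sum is, up
  to sign, \<open>w (1, d)\<close> times the nonzero value of \<open>v\<close> at
  \<open>- 1\<close>.\<close>

lemma shift_sum_kernel_image_vanishes:
  fixes u :: "nat \<times> nat \<Rightarrow> 'f::field" and n A B t R S :: nat
  defines "Q \<equiv> CHAR('f) ^ n"
  assumes prime: "prime CHAR('f)" and bound: "A + B + t + 1 < CHAR('f)"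
    and u: "u \<in> box_funs ((A + t + 1) * Q + R) ((B + t + 1) * Q + S)"
    and ker: "shift_sum ((shift_sum ^^ ((A + B + 1) * Q)) u) = 0"
    and d: "t * Q + R + S + 1 \<le> d"
  shows "(shift_sum ^^ ((A + B + 1) * Q)) u (1, d) = 0"
proof -
  define w where "w = (shift_sum ^^ ((A + B + 1) * Q)) u"
  \<comment> \<open>The excess \<open>h\<close> in the first index moves the chosen positions onto
    the antidiagonal of \<open>d\<close>.\<close>
  define h where "h = d - (t * Q + R + S + 1)"
  obtain v :: "'f poly" where v: "degree v \<le> t" "poly v (- 1) \<noteq> 0"
    "\<And>i. A + 1 \<le> i \<Longrightarrow> i \<le> A + t \<Longrightarrow> coeff ([:1, 1:] ^ (A + B + 1) * v) i = 0"
    using binomial_window_annihilator[OF bound] by blast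
  let ?b = "[:1, 1:] ^ (A + B + 1) :: 'f poly"
  have degb: "degree ?b \<le> A + B + 1"
    by (simp only: degree_linear_power)
  have mQ: "(- 1 :: 'f) ^ Q = - 1"
    unfolding Q_def by (rule minus_one_power_CHAR_power[OF prime])
  \<comment> \<open>The offsets \<open>R\<close> and \<open>S\<close> are chosen so that the first
    index exceeds \<open>(A + t + 1) * Q + R\<close> once \<open>i > A + t\<close>, and the second
    exceeds \<open>(B + t + 1) * Q + S\<close> as long as \<open>i \<le> A\<close>.\<close>
  let ?f = "\<lambda>i. u (i * Q + R + h + 1, (A + B + t + 1 - i) * Q + S + 1)"
  have "(\<Sum>e\<le>t. coeff v e * w (e * Q + R + h + 1, (t - e) * Q + S + 1))
      = (\<Sum>e\<le>t. \<Sum>i\<le>A + B + 1. coeff v e * coeff ?b i * ?f (e + i))"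
  proof (rule sum.cong[OF refl])
    fix e assume e: "e \<in> {..t}"
    have "w (e * Q + R + h + 1, (t - e) * Q + S + 1) = (\<Sum>i\<le>A + B + 1. of_nat ((A + B + 1) choose i) *
        u (e * Q + R + h + 1 + i * Q, (t - e) * Q + S + 1 + (A + B + 1 - i) * Q))"
      unfolding w_def Q_def by (rule shift_sum_funpow_mult_CHAR_power[OF prime]) simp_all
    also have "\<dots> = (\<Sum>i\<le>A + B + 1. coeff ?b i * ?f (e + i))"
    proof (rule sum.cong[OF refl])
      fix i assume i: "i \<in> {..A + B + 1}"
      have "A + B + t + 1 - (e + i) = (t - e) + (A + B + 1 - i)" using e i by simp
      then have "(A + B + t + 1 - (e + i)) * Q = (t - e) * Q + (A + B + 1 - i) * Q"
        by (simp only: distrib_right)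
      moreover have "(e + i) * Q = e * Q + i * Q" by (rule distrib_right)
      ultimately show "of_nat ((A + B + 1) choose i) *
          u (e * Q + R + h + 1 + i * Q, (t - e) * Q + S + 1 + (A + B + 1 - i) * Q)
          = coeff ?b i * ?f (e + i)"
        unfolding coeff_one_plus_X_power by (simp only: ac_simps)
    qed
    finally show "coeff v e * w (e * Q + R + h + 1, (t - e) * Q + S + 1)
        = (\<Sum>i\<le>A + B + 1. coeff v e * coeff ?b i * ?f (e + i))"
      by (simp only: sum_distrib_left mult.assoc)
  qed
  also have "\<dots> = (\<Sum>i\<le>t + (A + B + 1). coeff (v * ?b) i * ?f i)"
    by (rule sum_coeff_mult[OF v(1) degb])
  also have "\<dots> = 0"
  proof (intro sum.neutral ballI)
    fix i assume i: "i \<in> {..t + (A + B + 1)}"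
    consider "i \<le> A" | "A + 1 \<le> i" "i \<le> A + t" | "A + t + 1 \<le> i" by linarith
    then show "coeff (v * ?b) i * ?f i = 0"
    proof cases
      case 1
      then have "(B + t + 1) * Q \<le> (A + B + t + 1 - i) * Q" by (intro mult_le_mono1) simp
      then have "?f i = 0" by (intro box_funsD[OF u]) simp
      then show ?thesis by simp
    next
      case 2
      then show ?thesis using v(3) by (simp only: mult.commute[of v]) simp
    next
      case 3
      then have "(A + t + 1) * Q \<le> i * Q" by (intro mult_le_mono1)
      then have "?f i = 0" by (intro box_funsD[OF u]) simp
      then show ?thesis by simp
    qed
  qed
  finally have zero: "(\<Sum>e\<le>t. coeff v e * w (e * Q + R + h + 1, (t - e) * Q + S + 1)) = 0" .
  have "w (e * Q + R + h + 1, (t - e) * Q + S + 1) = (- 1) ^ (R + h) * w (1, d) * (- 1) ^ e"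
    if "e \<le> t" for e
  proof -
    have "e * Q + (t - e) * Q = t * Q" using that by (simp flip: distrib_right)
    then have "Suc (e * Q + R + h + ((t - e) * Q + S)) = d" using d by (simp add: h_def)
    moreover have "(- 1 :: 'f) ^ (e * Q) = (- 1) ^ e"
      by (subst mult.commute) (simp add: power_mult mQ)
    ultimately show ?thesis
      using shift_sum_kernel[OF ker[folded w_def], of "e * Q + R + h" "(t - e) * Q + S"]
      by (simp add: power_add)
  qed
  then have "(\<Sum>e\<le>t. coeff v e * w (e * Q + R + h + 1, (t - e) * Q + S + 1))
      = (\<Sum>e\<le>t. (- 1) ^ (R + h) * w (1, d) * (coeff v e * (- 1) ^ e))"
    by (intro sum.cong) simp_all
  also have "\<dots> = (- 1) ^ (R + h) * w (1, d) * (\<Sum>e\<le>t. coeff v e * (- 1) ^ e)"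
    by (simp only: sum_distrib_left)
  also have "(\<Sum>e\<le>t. coeff v e * (- 1) ^ e) = poly v (- 1)"
    unfolding poly_altdef using v(1) by (intro sum.mono_neutral_right) (auto simp: coeff_eq_0)
  finally have "(- 1) ^ (R + h) * w (1, d) * poly v (- 1) = 0" using zero by simp
  then show ?thesis using v(2) by (simp add: w_def)
qed

subsection \<open>String lengths\<close>

text \<open>Coordinates on the direct sum of the \<open>Vmod \<rho> (lam k)\<close>: position
  \<open>(k, i)\<close> belongs to the \<open>i\<close>-th basis vector of the \<open>k\<close>-th
  summand, and \<open>g - 1\<close> acts as \<open>string_shift\<close>.\<close>

definition string_funs :: "nat \<Rightarrow> (nat \<Rightarrow> nat) \<Rightarrow> (nat \<times> nat \<Rightarrow> 'f::zero) set" where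
  "string_funs m lam = {x. \<forall>k i. k \<notin> {1..m} \<or> i \<notin> {1..lam k} \<longrightarrow> x (k, i) = 0}"

definition string_shift :: "(nat \<times> nat \<Rightarrow> 'f::zero) \<Rightarrow> nat \<times> nat \<Rightarrow> 'f" where
  "string_shift x = (\<lambda>(k, i). if 1 \<le> i then x (k, i + 1) else 0)"

lemma string_shift_funpow: "1 \<le> i \<Longrightarrow> (string_shift ^^ m) x (k, i) = x (k, i + m)"
  by (induction m arbitrary: i) (auto simp: string_shift_def)

lemma string_funsD: "x \<in> string_funs m lam \<Longrightarrow> k \<notin> {1..m} \<or> i \<notin> {1..lam k} \<Longrightarrow> x (k, i) = 0"
  by (auto simp: string_funs_def)

lemma subspace_box_funs: "fsp.subspace (box_funs r s)"
  by (rule fsp.subspaceI) (auto simp: box_funs_def fscale_def)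

lemma shift_sum_sum:
  "shift_sum (\<Sum>d\<in>D. fscale (c d) (u d)) = (\<Sum>d\<in>D. fscale (c d) (shift_sum (u d)))"
  by (auto simp: shift_sum_def fun_eq_iff sum_fun_apply fscale_def sum.distrib algebra_simps)

lemma shift_sum_funpow_sum:
  "(shift_sum ^^ m) (\<Sum>d\<in>D. fscale (c d) (u d)) = (\<Sum>d\<in>D. fscale (c d) ((shift_sum ^^ m) (u d)))"
  by (induction m) (auto simp: shift_sum_sum)

lemma linear_on_zero:
  assumes "fsp.subspace U" "linear_on U f" shows "f 0 = 0"
  using linear_on_sum[OF assms, of "{} :: nat set"] by simp

lemma box_funs_kernel_eq_0:
  assumes w: "w \<in> box_funs r s" "shift_sum w = 0" and "\<And>d. w (1, d) = 0"
  shows "w = 0"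
proof
  fix ij :: "nat \<times> nat"
  obtain i j where ij: "ij = (i, j)" by (cases ij)
  show "w ij = 0 ij"
  proof (cases "i = 0 \<or> j = 0")
    case True
    then show ?thesis using box_funsD[OF w(1)] by (auto simp: ij)
  next
    case False
    then obtain i' j' where "i = Suc i'" "j = Suc j'" by (metis not0_implies_Suc)
    then show ?thesis using shift_sum_kernel[OF w(2), of i' j'] assms(3) by (simp add: ij)
  qed
qed

text \<open>The number of strings of length at least \<open>L\<close> is the dimension of the part
  of the kernel lying in the image of \<open>N ^ (L - 1)\<close>. If \<open>L < lam l\<close>, the
  first \<open>l\<close> strings give \<open>l\<close> independent kernel vectors in the image of
  \<open>N ^ L\<close>, but \<open>upper\<close> leaves only the \<open>l - 1\<close> coefficients
  at \<open>x_1, ..., x_(l-1)\<close> free. If \<open>lam l < L\<close>, fewer than \<open>l\<close>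
  strings reach height \<open>L\<close>, but \<open>lower\<close> puts \<open>l\<close> independent
  kernel vectors into the image of \<open>N ^ (L - 1)\<close>. Each time \<open>l - 1\<close>
  equations in \<open>l\<close> unknowns give the contradiction.\<close>

lemma string_length_eq:
  fixes F :: "(nat \<times> nat \<Rightarrow> 'f::field) \<Rightarrow> nat \<times> nat \<Rightarrow> 'f"
  assumes bij: "bij_betw F (box_funs r s) (string_funs m lam)"
    and lin: "linear_on (box_funs r s) F"
    and comm: "\<And>w. w \<in> box_funs r s \<Longrightarrow> F (shift_sum w) = string_shift (F w)"
    and anti: "\<And>i j. 1 \<le> i \<Longrightarrow> i \<le> j \<Longrightarrow> j \<le> m \<Longrightarrow> lam j \<le> lam i"
    and l: "1 \<le> l" "l \<le> m" "l \<le> r" "l \<le> s" and L: "1 \<le> L"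
    and lower: "\<And>d. 1 \<le> d \<Longrightarrow> d \<le> l \<Longrightarrow> \<exists>u\<in>box_funs r s. (shift_sum ^^ (L - 1)) u = (alt_diag d :: _ \<Rightarrow> 'f)"
    and upper: "\<And>(u :: _ \<Rightarrow> 'f) d. u \<in> box_funs r s \<Longrightarrow> shift_sum ((shift_sum ^^ L) u) = 0 \<Longrightarrow> l \<le> d \<Longrightarrow>
      (shift_sum ^^ L) u (1, d) = 0"
  shows "lam l = L"
proof -
  let ?A = "box_funs r s :: (nat \<times> nat \<Rightarrow> 'f) set" and ?B = "string_funs m lam :: (nat \<times> nat \<Rightarrow> 'f) set"
  have FB: "F w \<in> ?B" if "w \<in> ?A" for w
    using bij that by (auto simp: bij_betw_def)
  have inj: "w = 0" if "w \<in> ?A" "F w = 0" for w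
    using bij that linear_on_zero[OF subspace_box_funs lin] fsp.subspace_0[OF subspace_box_funs]
    by (metis bij_betw_def inj_onD)
  have commn: "F ((shift_sum ^^ k) w) = (string_shift ^^ k) (F w)" if "w \<in> ?A" for w k
    using that by (induction k) (auto simp: comm shift_sum_funpow_in_box_funs)
  have Asum: "(\<Sum>d\<le>l - 1. fscale (c d) (u d)) \<in> ?A" if "\<And>d. d \<le> l - 1 \<Longrightarrow> u d \<in> ?A" for c u
    using that by (auto intro!: fsp.subspace_sum[OF subspace_box_funs] fsp.subspace_scale[OF subspace_box_funs])
  have Fsum: "F (\<Sum>d\<le>l - 1. fscale (c d) (u d)) = (\<Sum>d\<le>l - 1. fscale (c d) (F (u d)))"
    if "\<And>d. d \<le> l - 1 \<Longrightarrow> u d \<in> ?A" for c u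
    by (rule linear_on_sum[OF subspace_box_funs lin]) (use that in auto)
  have "\<not> L < lam l"
  proof
    assume less: "L < lam l"
    \<comment> \<open>The unit vector at height \<open>L + 1\<close> of string \<open>d + 1\<close>;
      applying \<open>string_shift\<close> \<open>L\<close> times takes it to the bottom of that
      string.\<close>
    define e :: "nat \<Rightarrow> nat \<times> nat \<Rightarrow> 'f" where
      "e d = (\<lambda>ki. if ki = (d + 1, L + 1) then 1 else 0)" for d
    have "\<exists>u\<in>?A. F u = e d" if "d \<le> l - 1" for d
    proof -
      have "d + 1 \<le> l" using that l by simp
      then have "lam l \<le> lam (d + 1)" by (intro anti) (use l in auto)
      then have "e d \<in> ?B" using less l that by (auto simp: e_def string_funs_def)
      then show ?thesis using bij by (metis (no_types, lifting) bij_betw_def imageE)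
    qed
    then obtain u where u: "\<And>d. d \<le> l - 1 \<Longrightarrow> u d \<in> ?A" "\<And>d. d \<le> l - 1 \<Longrightarrow> F (u d) = e d"
      by metis
    \<comment> \<open>The equations kill the first-row entries \<open>1, ..., l - 1\<close>, those
      that \<open>upper\<close> does not reach.\<close>
    obtain c where c: "\<exists>d\<le>l - 1. c d \<noteq> 0"
      "\<And>i. i < l - 1 \<Longrightarrow> (\<Sum>d\<le>l - 1. (shift_sum ^^ L) (u d) (1, i + 1) * c d) = 0"
      using homogeneous_system_nontrivial[of "l - 1" "\<lambda>i d. (shift_sum ^^ L) (u d) (1, i + 1)"] by blast
    define U where "U = (\<Sum>d\<le>l - 1. fscale (c d) (u d))"
    have UA: "U \<in> ?A" unfolding U_def by (rule Asum) (rule u(1))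
    have FU: "F U (k, i) = (\<Sum>d\<le>l - 1. if (k, i) = (d + 1, L + 1) then c d else 0)" for k i
      unfolding U_def by (subst Fsum[OF u(1)]) (auto simp: sum_fun_apply fscale_def u(2) e_def intro!: sum.cong)
    have TA: "(shift_sum ^^ L) U \<in> ?A" by (rule shift_sum_funpow_in_box_funs[OF UA])
    have ker: "shift_sum ((shift_sum ^^ L) U) = 0"
    proof (rule inj)
      show "shift_sum ((shift_sum ^^ L) U) \<in> ?A" by (rule shift_sum_in_box_funs[OF TA])
      show "F (shift_sum ((shift_sum ^^ L) U)) = 0"
        unfolding comm[OF TA] commn[OF UA]
        by (auto simp: fun_eq_iff string_shift_def string_shift_funpow FU)
    qed
    have "(shift_sum ^^ L) U (1, d) = 0" for d
    proof (cases "l \<le> d")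
      case True
      then show ?thesis by (rule upper[OF UA ker])
    next
      case False
      show ?thesis
      proof (cases d)
        case 0
        then show ?thesis using box_funsD[OF TA] by simp
      next
        case (Suc i)
        have "(shift_sum ^^ L) U (1, d) = (\<Sum>j\<le>l - 1. (shift_sum ^^ L) (u j) (1, i + 1) * c j)"
          unfolding U_def shift_sum_funpow_sum sum_fun_apply by (simp add: fscale_def Suc mult.commute)
        then show ?thesis using c(2) False Suc by simp
      qed
    qed
    then have "(shift_sum ^^ L) U = 0" by (rule box_funs_kernel_eq_0[OF TA ker])
    then have "F ((shift_sum ^^ L) U) = 0"
      using linear_on_zero[OF subspace_box_funs lin] by simp
    then have "F U (k, L + 1) = 0" for k
      using string_shift_funpow[of 1 L "F U" k] by (simp add: commn[OF UA])
    moreover have "F U (d + 1, L + 1) = c d" if "d \<le> l - 1" for d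
      using that by (simp add: FU)
    ultimately show False using c(1) by metis
  qed
  moreover have "\<not> lam l < L"
  proof
    assume less: "lam l < L"
    have "\<exists>u\<in>?A. (shift_sum ^^ (L - 1)) u = alt_diag (d + 1)" if "d \<le> l - 1" for d
      by (rule lower) (use that l in auto)
    then obtain u where u: "\<And>d. d \<le> l - 1 \<Longrightarrow> u d \<in> ?A"
      "\<And>d. d \<le> l - 1 \<Longrightarrow> (shift_sum ^^ (L - 1)) (u d) = alt_diag (d + 1)"
      by metis
    \<comment> \<open>The equations kill height \<open>L\<close> of the strings
      \<open>1, ..., l - 1\<close>; the strings from \<open>l\<close> on are shorter than
      \<open>L\<close>.\<close>
    obtain c where c: "\<exists>d\<le>l - 1. c d \<noteq> 0"
      "\<And>i. i < l - 1 \<Longrightarrow> (\<Sum>d\<le>l - 1. F (u d) (i + 1, L) * c d) = 0"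
      using homogeneous_system_nontrivial[of "l - 1" "\<lambda>i d. F (u d) (i + 1, L)"] by blast
    define U where "U = (\<Sum>d\<le>l - 1. fscale (c d) (u d))"
    define V where "V = (shift_sum ^^ (L - 1)) U"
    have UA: "U \<in> ?A" unfolding U_def by (rule Asum) (rule u(1))
    have VA: "V \<in> ?A" unfolding V_def by (rule shift_sum_funpow_in_box_funs[OF UA])
    have V: "V = (\<Sum>d\<le>l - 1. fscale (c d) (alt_diag (d + 1)))"
      unfolding V_def U_def shift_sum_funpow_sum by (rule sum.cong) (simp_all only: atMost_iff u(2))
    have "shift_sum V = (\<Sum>d\<le>l - 1. fscale (c d) (shift_sum (alt_diag (d + 1))))"
      unfolding V by (rule shift_sum_sum)
    also have "\<dots> = 0"
      by (simp add: shift_sum_alt_diag)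
    finally have ker: "shift_sum V = 0" .
    have FV: "F V (k, i) = F U (k, i + (L - 1))" if "1 \<le> i" for k i
      unfolding V_def commn[OF UA] by (rule string_shift_funpow[OF that])
    have FU: "F U (k, L) = 0" for k
    proof (cases "k \<notin> {1..m} \<or> l \<le> k")
      case True
      then have "k \<notin> {1..m} \<or> L \<notin> {1..lam k}"
        using anti[of l k] l less by auto
      then show ?thesis by (rule string_funsD[OF FB[OF UA]])
    next
      case False
      then obtain i where i: "k = i + 1" "i < l - 1"
        by (intro that[of "k - 1"]) auto
      have "F U (k, L) = (\<Sum>d\<le>l - 1. F (u d) (i + 1, L) * c d)"
        unfolding U_def by (subst Fsum[OF u(1)]) (auto simp: sum_fun_apply fscale_def i mult.commute)
      then show ?thesis using c(2)[OF i(2)] by simp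
    qed
    \<comment> \<open>As a kernel vector \<open>F V\<close> lives at height \<open>1\<close>, where
      it equals \<open>F U\<close> at height \<open>L\<close>.\<close>
    have "F V = 0"
    proof
      fix ki :: "nat \<times> nat"
      obtain k i where ki: "ki = (k, i)" by (cases ki)
      consider "i = 0" | "i = 1" | i' where "i = Suc i'" "1 \<le> i'"
        by (metis One_nat_def less_one linorder_not_le not0_implies_Suc)
      then show "F V ki = 0 ki"
      proof cases
        case 1
        then show ?thesis using string_funsD[OF FB[OF VA]] by (simp add: ki)
      next
        case 2
        then show ?thesis using FV[of 1 k] FU[of k] L by (simp add: ki)
      next
        case 3
        have "string_shift (F V) = 0"
          using comm[OF VA] ker linear_on_zero[OF subspace_box_funs lin] by simp
        then have "string_shift (F V) (k, i') = 0" by simp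
        then show ?thesis using 3 by (simp add: ki string_shift_def)
      qed
    qed
    then have "V = 0" by (rule inj[OF VA])
    moreover have "V (1, d + 1) = c d" if "d \<le> l - 1" for d
    proof -
      have "V (1, d + 1) = (\<Sum>d'\<le>l - 1. if d' = d then c d' else 0)"
        unfolding V sum_fun_apply by (rule sum.cong) (auto simp: fscale_def alt_diag_def)
      then show ?thesis using that by simp
    qed
    ultimately show False using c(1) by (metis zero_fun_apply)
  qed
  ultimately show ?thesis by simp
qed

text \<open>Shifting \<open>w\<close> by \<open>e - d\<close> rows commutes with
  \<open>shift_sum\<close> and turns \<open>alt_diag e\<close> into \<open>alt_diag d\<close> up to
  a sign, which the scalar in the witness corrects.\<close>

lemma alt_diag_image_initial:
  fixes w :: "nat \<times> nat \<Rightarrow> 'f::field"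
  assumes "w \<in> box_funs r s" "(shift_sum ^^ m) w = alt_diag e" "d \<le> e"
  shows "\<exists>u\<in>box_funs r s. (shift_sum ^^ m) u = (alt_diag d :: _ \<Rightarrow> 'f)"
proof
  let ?h = "e - d"
  \<comment> \<open>Written as a sum over a one-point set so that
    \<open>shift_sum_funpow_sum\<close> handles the scalar.\<close>
  let ?u = "\<Sum>x\<in>{()}. fscale ((- 1) ^ ?h) (row_shift ?h w)"
  show "?u \<in> box_funs r s"
    using row_shift_in_box_funs[OF assms(1)]
    by (auto intro: fsp.subspace_sum[OF subspace_box_funs] fsp.subspace_scale[OF subspace_box_funs])
  have "row_shift ?h (alt_diag e) = (\<lambda>ij. (- 1) ^ ?h * alt_diag d ij :: 'f)"
    using row_shift_alt_diag[of ?h d] assms(3) by simp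
  then have "(shift_sum ^^ m) (row_shift ?h w) = fscale ((- 1) ^ ?h) (alt_diag d)"
    unfolding shift_sum_funpow_row_shift assms(2) by (simp add: fscale_def)
  then show "(shift_sum ^^ m) ?u = alt_diag d"
    unfolding shift_sum_funpow_sum by (simp flip: power_add)
qed

subsection \<open>The action on the tensor product\<close>

locale jordan_action =
  fixes G :: "('g, 'm) monoid_scheme" and g :: 'g
    and \<rho> :: "'g \<Rightarrow> (nat \<Rightarrow> 'f::field) \<Rightarrow> nat \<Rightarrow> 'f" and q :: nat
  assumes G: "group G" and g: "g \<in> carrier G" and gen: "generate G {g} = carrier G"
    and finG: "finite (carrier G)"
    and module: "is_fg_module G (Vmod \<rho> q)"
    and act_1: "\<rho> g (bvec 1) = bvec 1"
    and act_Suc: "\<And>i. 1 < i \<Longrightarrow> i \<le> q \<Longrightarrow> \<rho> g (bvec i) = bvec (i - 1) + bvec i"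
begin

section \<open>The modules as spaces of coordinate functions\<close>

lemma Vmod_space: "fg_space (Vmod \<rho> s) = {y. \<forall>j. j \<notin> {1..s} \<longrightarrow> y j = 0}"
proof
  show "fg_space (Vmod \<rho> s) \<subseteq> {y. \<forall>j. j \<notin> {1..s} \<longrightarrow> y j = 0}"
  proof -
    have "fsp.subspace {y :: nat \<Rightarrow> 'f. \<forall>j. j \<notin> {1..s} \<longrightarrow> y j = 0}"
      by (rule fsp.subspaceI) (auto simp: fscale_def)
    then show ?thesis
      unfolding Vmod_def fgmod.simps by (intro fsp.span_minimal) (auto simp: bvec_def)
  qed
  show "{y. \<forall>j. j \<notin> {1..s} \<longrightarrow> y j = 0} \<subseteq> fg_space (Vmod \<rho> s)"
  proof
    fix y :: "nat \<Rightarrow> 'f" assume y: "y \<in> {y. \<forall>j. j \<notin> {1..s} \<longrightarrow> y j = 0}"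
    have "y = (\<Sum>i\<in>{1..s}. fscale (y i) (bvec i))"
      using y by (auto simp: fun_eq_iff sum_fun_apply fscale_def bvec_def if_distrib cong: if_cong)
    also have "\<dots> \<in> fsp.span (bvec ` {1..s})"
      by (intro fsp.span_sum fsp.span_scale fsp.span_base) auto
    finally show "y \<in> fg_space (Vmod \<rho> s)" by (simp add: Vmod_def)
  qed
qed

lemma Vmod_mono: "y \<in> fg_space (Vmod \<rho> s) \<Longrightarrow> s \<le> q \<Longrightarrow> y \<in> fg_space (Vmod \<rho> q)"
  by (auto simp: Vmod_space)

lemma subspace_Vmod: "fsp.subspace (fg_space (Vmod \<rho> s))"
  by (simp add: Vmod_def)

lemma linear_on_act: "h \<in> carrier G \<Longrightarrow> s \<le> q \<Longrightarrow> linear_on (fg_space (Vmod \<rho> s)) (\<rho> h)"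
  using module Vmod_mono by (auto simp: is_fg_module_def linear_on_def Vmod_def)

lemma act_mult:
  "h \<in> carrier G \<Longrightarrow> k \<in> carrier G \<Longrightarrow> s \<le> q \<Longrightarrow> y \<in> fg_space (Vmod \<rho> s) \<Longrightarrow>
    \<rho> (h \<otimes>\<^bsub>G\<^esub> k) y = \<rho> h (\<rho> k y)"
  using module Vmod_mono[of y s] by (auto simp: is_fg_module_def Vmod_def)

lemma act_one: "s \<le> q \<Longrightarrow> y \<in> fg_space (Vmod \<rho> s) \<Longrightarrow> \<rho> \<one>\<^bsub>G\<^esub> y = y"
  using module Vmod_mono[of y s] by (auto simp: is_fg_module_def Vmod_def)

lemma act_bvec:
  assumes "1 \<le> i" "i \<le> q"
  shows "\<rho> g (bvec i) j = (if j = i \<or> (1 \<le> j \<and> j + 1 = i) then 1 else 0)"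
  using assms act_1 act_Suc[of i] by (cases "i = 1") (auto simp: bvec_def)

lemma act_expand:
  assumes "h \<in> carrier G" "s \<le> q" "y \<in> fg_space (Vmod \<rho> s)"
  shows "\<rho> h y = (\<Sum>i\<in>{1..s}. fscale (y i) (\<rho> h (bvec i)))"
  by (subst Vmod_expand[OF assms(3)], rule linear_on_sum[OF subspace_Vmod linear_on_act[OF assms(1,2)]])
    (auto intro: bvec_in_Vmod)

lemma act_apply:
  assumes "s \<le> q" "y \<in> fg_space (Vmod \<rho> s)"
  shows "\<rho> g y j = y j + (if 1 \<le> j then y (j + 1) else 0)"
proof -
  have y: "y i = 0" if "i \<notin> {1..s}" for i
    using assms(2) that by (simp add: Vmod_space)
  have "\<rho> g y j = (\<Sum>i\<in>{1..s}. y i * (if j = i \<or> (1 \<le> j \<and> j + 1 = i) then 1 else 0))"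
    unfolding act_expand[OF g assms] sum_fun_apply fscale_def
    by (rule sum.cong) (use assms(1) in \<open>auto simp: act_bvec\<close>)
  also have "\<dots> = (\<Sum>i\<in>{1..s}. (if i = j then y i else 0) + (if i = j + 1 then if 1 \<le> j then y i else 0 else 0))"
    by (rule sum.cong) auto
  also have "\<dots> = y j + (if 1 \<le> j then y (j + 1) else 0)"
    unfolding sum.distrib using y[of j] y[of "j + 1"] by auto
  finally show ?thesis .
qed

text \<open>In a finite cyclic group every element, inverses included, is a natural power of
  \<open>g\<close>, and \<open>g\<close> itself preserves the support by
  \<open>act_apply\<close>.\<close>

lemma act_closed:
  assumes "h \<in> carrier G" "s \<le> q" "y \<in> fg_space (Vmod \<rho> s)"
  shows "\<rho> h y \<in> fg_space (Vmod \<rho> s)"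
proof -
  interpret group G by (rule G)
  have "\<rho> (g [^]\<^bsub>G\<^esub> k) y \<in> fg_space (Vmod \<rho> s)" for k :: nat
  proof (induction k)
    case 0
    then show ?case using assms by (simp add: act_one)
  next
    case (Suc k)
    have "\<rho> (g [^]\<^bsub>G\<^esub> Suc k) y = \<rho> g (\<rho> (g [^]\<^bsub>G\<^esub> k) y)"
      unfolding nat_pow_Suc2[OF g] by (rule act_mult) (use g assms in auto)
    also have "\<dots> \<in> fg_space (Vmod \<rho> s)"
      using act_apply[OF assms(2) Suc] Suc by (auto simp: Vmod_space)
    finally show ?case .
  qed
  moreover obtain k :: nat where "h = g [^]\<^bsub>G\<^esub> k"
    using assms(1) generate_pow_on_finite_carrier[OF finG g] gen by auto
  ultimately show ?thesis by simp
qed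

lemma Vtensor_space: "fg_space (Vtensor \<rho> r s) = box_funs r s"
proof
  show "fg_space (Vtensor \<rho> r s) \<subseteq> box_funs r s"
    unfolding Vtensor_def fgmod.simps
    by (intro fsp.span_minimal subspace_box_funs) (auto simp: Vmod_space box_funs_def ptensor_def)
  show "box_funs r s \<subseteq> fg_space (Vtensor \<rho> r s)"
  proof
    fix w :: "nat \<times> nat \<Rightarrow> 'f" assume w: "w \<in> box_funs r s"
    have "w = (\<Sum>ij\<in>{1..r} \<times> {1..s}. fscale (w ij) (ptensor (bvec (fst ij)) (bvec (snd ij))))"
    proof
      fix ab :: "nat \<times> nat"
      obtain a b where ab: "ab = (a, b)" by (cases ab)
      have "(\<Sum>ij\<in>{1..r} \<times> {1..s}. fscale (w ij) (ptensor (bvec (fst ij)) (bvec (snd ij)))) ab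
          = (\<Sum>ij\<in>{1..r} \<times> {1..s}. if ij = ab then w ij else 0)"
        unfolding sum_fun_apply
        by (rule sum.cong) (auto simp: fscale_def ptensor_def bvec_def ab)
      also have "\<dots> = w ab"
        using box_funsD[OF w, of a b] by (auto simp: ab)
      finally show "w ab = (\<Sum>ij\<in>{1..r} \<times> {1..s}. fscale (w ij) (ptensor (bvec (fst ij)) (bvec (snd ij)))) ab"
        by simp
    qed
    also have "\<dots> \<in> fg_space (Vtensor \<rho> r s)"
      unfolding Vtensor_def fgmod.simps
    proof (intro fsp.span_sum fsp.span_scale fsp.span_base)
      fix ij assume "ij \<in> {1..r} \<times> {1..s}"
      then have "bvec (fst ij) \<in> fg_space (Vmod \<rho> r)" "bvec (snd ij) \<in> fg_space (Vmod \<rho> s)"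
        by (auto intro!: bvec_in_Vmod)
      then show "ptensor (bvec (fst ij)) (bvec (snd ij))
          \<in> {ptensor x y |x y. x \<in> fg_space (Vmod \<rho> r) \<and> y \<in> fg_space (Vmod \<rho> s)}"
        by blast
    qed
    finally show "w \<in> fg_space (Vtensor \<rho> r s)" .
  qed
qed

lemma direct_sum_space:
  "fg_space (fg_direct_sum {1..m} (\<lambda>i. Vmod \<rho> (lam i))) = string_funs m lam"
proof -
  have fin: "finite {k. \<exists>i. x (k, i) \<noteq> 0}" if "\<forall>k i. k \<notin> {1..m} \<longrightarrow> x (k, i) = 0" for x :: "nat \<times> nat \<Rightarrow> 'f"
    by (rule finite_subset[of _ "{1..m}"]) (use that in auto)
  show ?thesis
    unfolding fg_direct_sum_def fgmod.simps Vmod_space string_funs_def using fin by auto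
qed

lemma gminus1_direct_sum:
  assumes "x \<in> string_funs m lam" and "\<And>i. i \<in> {1..m} \<Longrightarrow> lam i \<le> q"
  shows "gminus1 (fg_direct_sum {1..m} (\<lambda>i. Vmod \<rho> (lam i))) g x = string_shift x"
proof
  fix ki :: "nat \<times> nat"
  obtain k i where ki: "ki = (k, i)" by (cases ki)
  show "gminus1 (fg_direct_sum {1..m} (\<lambda>i. Vmod \<rho> (lam i))) g x ki = string_shift x ki"
  proof (cases "k \<in> {1..m}")
    case True
    have "(\<lambda>i. x (k, i)) \<in> fg_space (Vmod \<rho> (lam k))"
      using string_funsD[OF assms(1)] by (auto simp: Vmod_space)
    then show ?thesis
      using True act_apply[OF assms(2)[OF True], of "\<lambda>i. x (k, i)" i]
      by (simp add: gminus1_def fg_direct_sum_def ki string_shift_def Vmod_def)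
  next
    case False
    have "fg_act (fg_direct_sum {1..m} (\<lambda>i. Vmod \<rho> (lam i))) g x (k, i) = 0"
      unfolding fg_direct_sum_def fgmod.simps prod.case using False by (rule if_not_P)
    moreover have "x (k, j) = 0" for j
      using string_funsD[OF assms(1)] False by blast
    ultimately show ?thesis
      by (simp add: gminus1_def ki string_shift_def)
  qed
qed

section \<open>Change to the basis \<open>v_ij\<close>\<close>

text \<open>The coordinates of \<open>twist n w\<close> with respect to \<open>v\<^sub>i\<^sub>j\<close> are \<open>w\<close>.\<close>

definition twist :: "nat \<Rightarrow> (nat \<times> nat \<Rightarrow> 'f) \<Rightarrow> nat \<times> nat \<Rightarrow> 'f" where
  "twist n w = (\<lambda>(i, j). \<rho> (g [^]\<^bsub>G\<^esub> (int n - int i)) (\<lambda>j. w (i, j)) j)"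

lemma power_closed: "g [^]\<^bsub>G\<^esub> (z :: int) \<in> carrier G"
  using G g by (rule group.int_pow_closed)

lemma box_funs_row: "w \<in> box_funs r s \<Longrightarrow> (\<lambda>j. w (i, j)) \<in> fg_space (Vmod \<rho> s)"
  by (auto simp: Vmod_space box_funs_def)

lemma act_0: "h \<in> carrier G \<Longrightarrow> \<rho> h 0 = 0"
  using linear_on_zero[OF subspace_Vmod linear_on_act] by blast

lemma act_add:
  "h \<in> carrier G \<Longrightarrow> s \<le> q \<Longrightarrow> x \<in> fg_space (Vmod \<rho> s) \<Longrightarrow> y \<in> fg_space (Vmod \<rho> s) \<Longrightarrow>
    \<rho> h (x + y) = \<rho> h x + \<rho> h y"
  using linear_on_act[of h s] by (auto simp: linear_on_def)

lemma act_scale: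
  "h \<in> carrier G \<Longrightarrow> s \<le> q \<Longrightarrow> x \<in> fg_space (Vmod \<rho> s) \<Longrightarrow> \<rho> h (fscale c x) = fscale c (\<rho> h x)"
  using linear_on_act[of h s] by (auto simp: linear_on_def)

lemma row_add: "(\<lambda>j. (v + w) (i, j)) = (\<lambda>j. v (i, j)) + (\<lambda>j. w (i, j))" for v w :: "nat \<times> nat \<Rightarrow> 'f"
  by (simp add: fun_eq_iff)

lemma row_scale: "(\<lambda>j. fscale c w (i, j)) = fscale c (\<lambda>j. w (i, j))" for w :: "nat \<times> nat \<Rightarrow> 'f"
  by (simp add: fun_eq_iff fscale_def)

lemma row_map_in_box_funs:
  assumes "s \<le> q" "w \<in> box_funs r s" "\<And>i. h i \<in> carrier G"
  shows "(\<lambda>(i, j). \<rho> (h i) (\<lambda>j. w (i, j)) j) \<in> box_funs r s"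
proof -
  have "\<rho> (h i) (\<lambda>j. w (i, j)) j = 0" if "i \<notin> {1..r} \<or> j \<notin> {1..s}" for i j
  proof (cases "i \<in> {1..r}")
    case True
    then show ?thesis
      using that act_closed[OF assms(3)[of i] assms(1) box_funs_row[OF assms(2), of i]]
      by (auto simp: Vmod_space)
  next
    case False
    then have "(\<lambda>j. w (i, j)) = 0" using assms(2) by (auto simp: box_funs_def fun_eq_iff)
    then show ?thesis by (simp add: act_0 assms(3))
  qed
  then show ?thesis by (auto simp: box_funs_def)
qed

lemma twist_in_box_funs: "s \<le> q \<Longrightarrow> w \<in> box_funs r s \<Longrightarrow> twist n w \<in> box_funs r s"
  unfolding twist_def by (rule row_map_in_box_funs) (auto simp: power_closed)

lemma linear_on_twist:
  assumes s: "s \<le> q"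
  shows "linear_on (box_funs r s) (twist n)"
proof -
  have "twist n (x + y) (i, j) = (twist n x + twist n y) (i, j)"
    if "x \<in> box_funs r s" "y \<in> box_funs r s" for x y i j
    unfolding twist_def prod.case row_add act_add[OF power_closed s box_funs_row[OF that(1)] box_funs_row[OF that(2)]]
    by simp
  moreover have "twist n (fscale c x) (i, j) = fscale c (twist n x) (i, j)" if "x \<in> box_funs r s" for c x i j
    unfolding twist_def prod.case row_scale act_scale[OF power_closed s box_funs_row[OF that]]
    by (simp add: fscale_def)
  ultimately show ?thesis unfolding linear_on_def fun_eq_iff by simp
qed

lemma bij_betw_twist:
  assumes "s \<le> q"
  shows "bij_betw (twist n) (box_funs r s) (box_funs r s)"
proof -
  interpret group G by (rule G)
  let ?h = "\<lambda>i. g [^]\<^bsub>G\<^esub> (int n - int i)"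
  let ?untwist = "\<lambda>w (i, j). \<rho> (inv\<^bsub>G\<^esub> ?h i) (\<lambda>j. w (i, j)) j"
  have cancel: "\<rho> (inv\<^bsub>G\<^esub> h) (\<rho> h y) = y" "\<rho> h (\<rho> (inv\<^bsub>G\<^esub> h) y) = y"
    if "h \<in> carrier G" "y \<in> fg_space (Vmod \<rho> s)" for h y
    using that assms act_mult[of "inv\<^bsub>G\<^esub> h" h s y] act_mult[of h "inv\<^bsub>G\<^esub> h" s y]
      act_one[of s y] by simp_all
  show ?thesis
  proof (rule bij_betw_byWitness[where f' = ?untwist])
    show "\<forall>w\<in>box_funs r s. ?untwist (twist n w) = w"
      by (auto simp: twist_def cancel power_closed box_funs_row fun_eq_iff)
    show "\<forall>w\<in>box_funs r s. twist n (?untwist w) = w"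
      by (auto simp: twist_def cancel power_closed box_funs_row fun_eq_iff)
    show "twist n ` box_funs r s \<subseteq> box_funs r s"
      using twist_in_box_funs[OF assms] by auto
    show "?untwist ` box_funs r s \<subseteq> box_funs r s"
      by (rule image_subsetI, rule row_map_in_box_funs[OF assms _ inv_closed[OF power_closed]])
  qed
qed

text \<open>The exponents \<open>n - i\<close> are made for this. Row \<open>a\<close> of the image
  under \<open>g\<close> is \<open>g\<close> applied to rows \<open>a\<close> and
  \<open>a + 1\<close>; since \<open>g\<close> times \<open>g ^ (n - (a + 1))\<close> is
  \<open>g ^ (n - a)\<close>, both parts carry the same twist \<open>g ^ (n - a)\<close>, which then
  comes off as a common factor.\<close>

lemma gminus1_twist:
  assumes r: "r \<le> q" and s: "s \<le> q" and w: "w \<in> box_funs r s"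
  shows "gminus1 (Vtensor \<rho> r s) g (twist n w) = twist n (shift_sum w)"
proof
  interpret group G by (rule G)
  fix ab :: "nat \<times> nat"
  obtain a b where ab: "ab = (a, b)" by (cases ab)
  let ?h = "\<lambda>i. g [^]\<^bsub>G\<^esub> (int n - int i)"
  let ?row = "\<lambda>w i j. w (i, j)"
  let ?T = "twist n w"
  have T: "?T \<in> box_funs r s" by (rule twist_in_box_funs[OF s w])
  have rowT: "?row ?T i = \<rho> (?h i) (?row w i)" for i
    by (simp add: twist_def)
  have row0: "?row v i = 0" if "v \<in> box_funs r s" "i \<notin> {1..r}" for v :: "nat \<times> nat \<Rightarrow> 'f" and i
    using that by (auto simp: box_funs_def fun_eq_iff)
  define Z where "Z i = \<rho> g (?row ?T i) b" for i
  have "fg_act (Vtensor \<rho> r s) g ?T (a, b)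
      = (\<Sum>i\<in>{1..r}. \<Sum>j\<in>{1..s}. ?T (i, j) * (\<rho> g (bvec i) a * \<rho> g (bvec j) b))"
    by (simp add: Vtensor_def sum_fun_apply fscale_def ptensor_def)
  also have "\<dots> = (\<Sum>i\<in>{1..r}. \<rho> g (bvec i) a * Z i)"
    unfolding Z_def act_expand[OF g s box_funs_row[OF T]] sum_fun_apply fscale_def sum_distrib_left
    by (simp only: ac_simps)
  also have "\<dots> = (\<Sum>i\<in>{1..r}. (if i = a then Z i else 0) + (if i = a + 1 then if 1 \<le> a then Z i else 0 else 0))"
    by (rule sum.cong) (use r in \<open>auto simp: act_bvec\<close>)
  also have "\<dots> = (if 1 \<le> a then Z a + Z (a + 1) else 0)"
  proof -
    have "Z i = 0" if "i \<notin> {1..r}" for i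
      using row0[OF T that] act_0[OF g] by (simp add: Z_def)
    then show ?thesis unfolding sum.distrib by auto
  qed
  finally have act: "fg_act (Vtensor \<rho> r s) g ?T (a, b) = (if 1 \<le> a then Z a + Z (a + 1) else 0)" .
  show "gminus1 (Vtensor \<rho> r s) g ?T ab = twist n (shift_sum w) ab"
  proof (cases "a = 0")
    case True
    have "?T (a, b) = 0" "shift_sum w (a, j) = 0" for j
      using box_funsD[OF T] True by (auto simp: shift_sum_def)
    moreover from this(2) have "?row (shift_sum w) a = 0" by (simp add: fun_eq_iff)
    ultimately show ?thesis
      using True act by (simp add: ab gminus1_def twist_def act_0 power_closed)
  next
    case False
    have comm: "g \<otimes>\<^bsub>G\<^esub> ?h i = ?h i \<otimes>\<^bsub>G\<^esub> g" for i
      using g int_pow_mult[OF g, of 1 "int n - int i"] int_pow_mult[OF g, of "int n - int i" 1]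
      by (simp add: add.commute)
    have step: "g \<otimes>\<^bsub>G\<^esub> ?h (a + 1) = ?h a"
      using g int_pow_mult[OF g, of 1 "int n - int (a + 1)"] by simp
    \<comment> \<open>Arranged without subtraction, because \<open>act_add\<close> covers sums
      only.\<close>
    have "?row (shift_sum w) a + ?row w a = ?row w (a + 1) + \<rho> g (?row w a)"
    proof
      fix j
      have "w (a, 0) = 0" "w (a + 1, 0) = 0" using box_funsD[OF w] by auto
      then show "(?row (shift_sum w) a + ?row w a) j = (?row w (a + 1) + \<rho> g (?row w a)) j"
        using False act_apply[OF s box_funs_row[OF w, of a], of j]
        by (cases j) (auto simp: shift_sum_def)
    qed
    then have "\<rho> (?h a) (?row (shift_sum w) a + ?row w a) = \<rho> (?h a) (?row w (a + 1) + \<rho> g (?row w a))"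
      by (rule arg_cong)
    then have "\<rho> (?h a) (?row (shift_sum w) a) + \<rho> (?h a) (?row w a)
        = \<rho> (?h a) (?row w (a + 1)) + \<rho> (?h a) (\<rho> g (?row w a))"
      by (simp only: act_add[OF power_closed s] box_funs_row[OF w]
          box_funs_row[OF shift_sum_in_box_funs[OF w]] act_closed[OF g s])
    also have "\<rho> (?h a) (\<rho> g (?row w a)) = \<rho> (?h a \<otimes>\<^bsub>G\<^esub> g) (?row w a)"
      by (rule act_mult[symmetric, OF power_closed g s box_funs_row[OF w]])
    also have "\<dots> = \<rho> g (?row ?T a)"
      unfolding rowT comm[symmetric] by (rule act_mult[OF g power_closed s box_funs_row[OF w]])
    also have "\<rho> (?h a) (?row w (a + 1)) = \<rho> g (?row ?T (a + 1))"
      unfolding rowT step[symmetric] by (rule act_mult[OF g power_closed s box_funs_row[OF w]])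
    finally have "\<rho> (?h a) (?row (shift_sum w) a) + ?row ?T a = \<rho> g (?row ?T (a + 1)) + \<rho> g (?row ?T a)"
      by (simp only: rowT)
    then have "(\<rho> (?h a) (?row (shift_sum w) a) + ?row ?T a) b = (\<rho> g (?row ?T (a + 1)) + \<rho> g (?row ?T a)) b"
      by simp
    then have "twist n (shift_sum w) (a, b) + ?T (a, b) = Z (a + 1) + Z a"
      by (simp add: Z_def twist_def)
    then show ?thesis
      using act False by (simp add: ab gminus1_def algebra_simps)
  qed
qed

lemma gminus1_funpow_twist:
  assumes "r \<le> q" "s \<le> q" "w \<in> box_funs r s"
  shows "(gminus1 (Vtensor \<rho> r s) g ^^ m) (twist n w) = twist n ((shift_sum ^^ m) w)"
  using assms by (induction m) (auto simp: gminus1_twist shift_sum_funpow_in_box_funs)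

text \<open>The dictionary between coordinate functions and combinations of \<open>vten\<close>;
  \<open>x_d\<close>, \<open>z\<close> and \<open>y\<close> are all translated through it.\<close>

lemma twist_sum_units:
  assumes s: "s \<le> q" and E: "finite E" and ab: "\<And>e. e \<in> E \<Longrightarrow> a e \<in> {1..r} \<and> b e \<in> {1..s}"
  shows "twist n (\<lambda>ij. \<Sum>e\<in>E. if ij = (a e, b e) then f e else 0)
    = (\<Sum>e\<in>E. fscale (f e) (vten G g \<rho> n (a e) (b e)))"
proof -
  let ?d = "\<lambda>e ij. if ij = (a e, b e) then 1 else 0 :: 'f"
  have "(\<lambda>ij. \<Sum>e\<in>E. if ij = (a e, b e) then f e else 0) = (\<Sum>e\<in>E. fscale (f e) (?d e))"
    by (auto simp: fun_eq_iff sum_fun_apply fscale_def intro!: sum.cong)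
  then have "twist n (\<lambda>ij. \<Sum>e\<in>E. if ij = (a e, b e) then f e else 0)
      = twist n (\<Sum>e\<in>E. fscale (f e) (?d e))"
    by (rule arg_cong)
  also have "\<dots> = (\<Sum>e\<in>E. fscale (f e) (twist n (?d e)))"
    by (rule linear_on_sum[OF subspace_box_funs linear_on_twist[OF s, of r] E])
      (use ab in \<open>auto simp: box_funs_def\<close>)
  also have "\<dots> = (\<Sum>e\<in>E. fscale (f e) (vten G g \<rho> n (a e) (b e)))"
  proof (rule sum.cong[OF refl])
    fix e assume "e \<in> E"
    then have pos: "a e \<noteq> 0" "b e \<noteq> 0" using ab[of e] by auto
    have "twist n (?d e) = vten G g \<rho> n (a e) (b e)"
    proof
      fix ij :: "nat \<times> nat"
      obtain i j where ij: "ij = (i, j)" by (cases ij)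
      have "(\<lambda>j. ?d e (i, j)) = (if i = a e then bvec (b e) else 0)"
        by (auto simp: bvec_def fun_eq_iff)
      then show "twist n (?d e) ij = vten G g \<rho> n (a e) (b e) ij"
        using pos act_0[OF power_closed]
        by (simp add: ij twist_def vten_def ptensor_def bvec_def[of "a e"])
    qed
    then show "fscale (f e) (twist n (?d e)) = fscale (f e) (vten G g \<rho> n (a e) (b e))" by simp
  qed
  finally show ?thesis .
qed

lemma Dspace_eq:
  assumes s: "s \<le> q"
  shows "Dspace G g \<rho> n r s d = twist n ` {w \<in> box_funs r s. \<forall>i j. i + j \<noteq> d + 1 \<longrightarrow> w (i, j) = 0}"
    (is "_ = twist n ` ?W")
proof
  have lin: "linear_on (box_funs r s) (twist n)" by (rule linear_on_twist[OF s])
  have W: "fsp.subspace ?W"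
    by (rule fsp.subspaceI) (auto simp: box_funs_def fscale_def)
  have "fsp.subspace (twist n ` ?W)"
  proof (rule fsp.subspaceI)
    have "twist n 0 = 0" by (rule linear_on_zero[OF subspace_box_funs lin])
    then show "0 \<in> twist n ` ?W" using fsp.subspace_0[OF W] by (rule image_eqI[OF sym])
    fix x assume "x \<in> twist n ` ?W"
    then obtain w where w: "w \<in> ?W" "x = twist n w" by blast
    have "fscale c x = twist n (fscale c w)" for c
      using lin w by (simp add: linear_on_def)
    then show "fscale c x \<in> twist n ` ?W" for c
      using fsp.subspace_scale[OF W w(1)] by (rule image_eqI)
    fix y assume "y \<in> twist n ` ?W"
    then obtain v where v: "v \<in> ?W" "y = twist n v" by blast
    have "x + y = twist n (w + v)" using lin w v by (simp add: linear_on_def)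
    then show "x + y \<in> twist n ` ?W"
      using fsp.subspace_add[OF W w(1) v(1)] by (rule image_eqI)
  qed
  moreover have "vten G g \<rho> n i j \<in> twist n ` ?W"
    if "1 \<le> i" "i \<le> r" "1 \<le> j" "j \<le> s" "i + j = d + 1" for i j
  proof -
    have "vten G g \<rho> n i j = twist n (\<lambda>ij. if ij = (i, j) then 1 else 0)"
      using twist_sum_units[OF s, of "{()}" "\<lambda>_. i" r "\<lambda>_. j" n "\<lambda>_. 1"] that
      by (simp add: fsp.scale_one)
    moreover have "(\<lambda>ij. if ij = (i, j) then 1 else 0) \<in> ?W"
      using that by (auto simp: box_funs_def)
    ultimately show ?thesis by blast
  qed
  ultimately show "Dspace G g \<rho> n r s d \<subseteq> twist n ` ?W"
    unfolding Dspace_def by (intro fsp.span_minimal) auto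
  show "twist n ` ?W \<subseteq> Dspace G g \<rho> n r s d"
  proof (rule image_subsetI)
    fix w assume w: "w \<in> ?W"
    let ?E = "{(i, j) \<in> {1..r} \<times> {1..s}. i + j = d + 1}"
    have fin: "finite ?E" by (rule finite_subset[of _ "{1..r} \<times> {1..s}"]) auto
    have "w = (\<lambda>ij. \<Sum>e\<in>?E. if ij = (fst e, snd e) then w e else 0)"
    proof
      fix ij :: "nat \<times> nat"
      have "(\<Sum>e\<in>?E. if ij = (fst e, snd e) then w e else 0) = (if ij \<in> ?E then w ij else 0)"
        using fin by simp
      also have "\<dots> = w ij" using w by (cases ij) (auto simp: box_funs_def)
      finally show "w ij = (\<Sum>e\<in>?E. if ij = (fst e, snd e) then w e else 0)" by simp
    qed
    then have "twist n w = twist n (\<lambda>ij. \<Sum>e\<in>?E. if ij = (fst e, snd e) then w e else 0)"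
      by (rule arg_cong)
    also have "\<dots> = (\<Sum>e\<in>?E. fscale (w e) (vten G g \<rho> n (fst e) (snd e)))"
      by (rule twist_sum_units[OF s fin, of fst r snd]) auto
    also have "\<dots> \<in> Dspace G g \<rho> n r s d"
      unfolding Dspace_def
    proof (intro fsp.span_sum fsp.span_scale fsp.span_base)
      fix e assume "e \<in> ?E"
      then have "1 \<le> fst e" "fst e \<le> r" "1 \<le> snd e" "snd e \<le> s" "fst e + snd e = d + 1"
        by auto
      then show "vten G g \<rho> n (fst e) (snd e)
          \<in> {vten G g \<rho> n i j |i j. 1 \<le> i \<and> i \<le> r \<and> 1 \<le> j \<and> j \<le> s \<and> i + j = d + 1}"
        by blast
    qed
    finally show "twist n w \<in> Dspace G g \<rho> n r s d" .
  qed
qed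

text \<open>Each application of \<open>g - 1\<close> lowers \<open>i + j\<close> by one.\<close>

lemma gminus1_funpow_Dspace:
  assumes "r \<le> q" "s \<le> q"
  shows "(gminus1 (Vtensor \<rho> r s) g ^^ m) ` Dspace G g \<rho> n r s (d + m) \<subseteq> Dspace G g \<rho> n r s d"
proof
  fix x assume "x \<in> (gminus1 (Vtensor \<rho> r s) g ^^ m) ` Dspace G g \<rho> n r s (d + m)"
  then obtain w where w: "w \<in> box_funs r s" "\<And>i j. i + j \<noteq> d + m + 1 \<Longrightarrow> w (i, j) = 0"
    and x: "x = (gminus1 (Vtensor \<rho> r s) g ^^ m) (twist n w)"
    unfolding Dspace_eq[OF assms(2)] by blast
  have "(shift_sum ^^ m) w \<in> box_funs r s" by (rule shift_sum_funpow_in_box_funs[OF w(1)])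
  moreover have "(shift_sum ^^ m) w (i, j) = 0" if "i + j \<noteq> d + 1" for i j
  proof (cases "1 \<le> i \<and> 1 \<le> j")
    case True
    then show ?thesis
      using that by (simp add: shift_sum_funpow) (intro sum.neutral, auto intro!: w(2))
  next
    case False
    then have "i \<notin> {1..r} \<or> j \<notin> {1..s}" by auto
    then show ?thesis by (rule box_funsD[OF shift_sum_funpow_in_box_funs[OF w(1)]])
  qed
  ultimately show "x \<in> Dspace G g \<rho> n r s d"
    unfolding Dspace_eq[OF assms(2)] x gminus1_funpow_twist[OF assms w(1)] by blast
qed

lemma twist_alt_diag:
  assumes "d \<le> r" "d \<le> s" "s \<le> q"
  shows "twist n (alt_diag d) = xvec G g \<rho> n d"
proof -
  have "alt_diag d = (\<lambda>ij. \<Sum>e\<in>{1..d}. if ij = (e, d + 1 - e) then (- 1) ^ (e - 1) else 0 :: 'f)"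
  proof
    fix ij :: "nat \<times> nat"
    obtain i j where ij: "ij = (i, j)" by (cases ij)
    have "(\<Sum>e\<in>{1..d}. if ij = (e, d + 1 - e) then (- 1) ^ (e - 1) else 0 :: 'f)
        = (\<Sum>e\<in>{1..d}. if e = i then if j = d + 1 - i then (- 1) ^ (i - 1) else 0 else 0)"
      by (rule sum.cong) (auto simp: ij)
    also have "\<dots> = alt_diag d ij"
      by (auto simp: ij alt_diag_def)
    finally show "alt_diag d ij = (\<Sum>e\<in>{1..d}. if ij = (e, d + 1 - e) then (- 1) ^ (e - 1) else (0 :: 'f))"
      by (rule sym)
  qed
  then have "twist n (alt_diag d)
      = twist n (\<lambda>ij. \<Sum>e\<in>{1..d}. if ij = (e, d + 1 - e) then (- 1) ^ (e - 1) else 0)"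
    by (rule arg_cong)
  also have "\<dots> = xvec G g \<rho> n d"
    unfolding xvec_def
  proof (rule twist_sum_units[OF assms(3), where r = r])
    fix e assume "e \<in> {1..d}"
    then show "e \<in> {1..r} \<and> d + 1 - e \<in> {1..s}" using assms(1,2) by auto
  qed simp
  finally show ?thesis .
qed

lemma twist_grid_fun:
  assumes "s \<le> q" and "c < Q" "1 \<le> A" "t < B" "(A + t) * Q \<le> r" "B * Q \<le> s"
  shows "twist n (grid_fun Q c t A B f)
    = (\<Sum>e\<in>{0..t}. fscale (f e) (vten G g \<rho> n ((A + e) * Q - c) ((B - e) * Q)))"
  unfolding grid_fun_units[OF assms(2,3)]
proof (rule twist_sum_units[OF assms(1), where r = r
      and a = "\<lambda>e. (A + e) * Q - c" and b = "\<lambda>e. (B - e) * Q"])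
  fix e assume e: "e \<in> {0..t}"
  have A: "(A + e) * Q \<le> (A + t) * Q" "1 * Q \<le> (A + e) * Q"
    by (rule mult_le_mono1, use e assms(3) in simp)+
  have B: "(B - e) * Q \<le> B * Q" "1 * Q \<le> (B - e) * Q"
    by (rule mult_le_mono1, use e assms(4) in simp)+
  have "1 \<le> (A + e) * Q - c" using A(2) assms(2) by linarith
  moreover have "(A + e) * Q - c \<le> r" using A(1) assms(5) by linarith
  moreover have "1 \<le> (B - e) * Q" using B(2) assms(2) by linarith
  moreover have "(B - e) * Q \<le> s" using B(1) assms(6) by linarith
  ultimately show "(A + e) * Q - c \<in> {1..r} \<and> (B - e) * Q \<in> {1..s}"
    by (simp only: atLeastAtMost_iff)
qed simp

lemma twist_grid_fun_in_Dspace: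
  assumes "s \<le> q" and "c < Q" "1 \<le> A" "t < B" "(A + t) * Q \<le> r" "B * Q \<le> s"
    and d: "d + 1 + c = (A + B) * Q"
  shows "twist n (grid_fun Q c t A B f) \<in> Dspace G g \<rho> n r s d"
proof -
  have "grid_fun Q c t A B f (i, j) = 0" if "i + j \<noteq> d + 1" for i j
  proof (rule grid_fun_eq_0, rule notI)
    fix e assume e: "e \<le> t" and eq: "i + c = (A + e) * Q \<and> j = (B - e) * Q"
    have "i + c + j = (A + e + (B - e)) * Q"
      using eq by (simp only: distrib_right)
    also have "A + e + (B - e) = A + B" using e assms(4) by simp
    finally show False using that d by simp
  qed
  then show ?thesis
    unfolding Dspace_eq[OF assms(1)] using grid_fun_in_box_funs[OF assms(2-6)] by blast
qed

text \<open>Composing the given isomorphism with \<open>twist\<close> turns \<open>shift_sum\<close>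
  on the box into \<open>string_shift\<close> on the strings, so that
  \<open>string_length_eq\<close> applies.\<close>

lemma tensor_string_length_eq:
  assumes "r \<le> q" "s \<le> q"
    and iso: "fg_iso G (Vtensor \<rho> r s) (fg_direct_sum {1..m} (\<lambda>i. Vmod \<rho> (lam i)))"
    and lam: "\<And>i. i \<in> {1..m} \<Longrightarrow> lam i \<le> q"
    and anti: "\<And>i j. 1 \<le> i \<Longrightarrow> i \<le> j \<Longrightarrow> j \<le> m \<Longrightarrow> lam j \<le> lam i"
    and l: "1 \<le> l" "l \<le> m" "l \<le> r" "l \<le> s" and L: "1 \<le> L"
    and lower: "\<And>d. 1 \<le> d \<Longrightarrow> d \<le> l \<Longrightarrow>
      \<exists>u\<in>box_funs r s. (shift_sum ^^ (L - 1)) u = (alt_diag d :: _ \<Rightarrow> 'f)"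
    and upper: "\<And>(u :: _ \<Rightarrow> 'f) d. u \<in> box_funs r s \<Longrightarrow> shift_sum ((shift_sum ^^ L) u) = 0 \<Longrightarrow> l \<le> d \<Longrightarrow>
      (shift_sum ^^ L) u (1, d) = 0"
  shows "lam l = L"
proof -
  let ?V = "Vtensor \<rho> r s" and ?W = "fg_direct_sum {1..m} (\<lambda>i. Vmod \<rho> (lam i))"
  obtain \<phi> where bij: "bij_betw \<phi> (box_funs r s) (string_funs m lam)"
    and lin: "linear_on (box_funs r s) \<phi>"
    and comm: "\<And>x. x \<in> box_funs r s \<Longrightarrow> \<phi> (fg_act ?V g x) = fg_act ?W g (\<phi> x)"
    using iso g unfolding fg_iso_def Vtensor_space direct_sum_space by blast
  \<comment> \<open>Any exponent would serve, as \<open>gminus1_twist\<close> holds for every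
    \<open>n\<close>; \<open>0\<close> is a choice.\<close>
  let ?F = "\<phi> \<circ> twist 0"
  have tw: "twist 0 w \<in> box_funs r s" if "w \<in> box_funs r s" for w
    by (rule twist_in_box_funs[OF assms(2) that])
  show ?thesis
  proof (rule string_length_eq[where F = ?F and r = r and s = s and m = m and lam = lam and l = l])
    show "bij_betw ?F (box_funs r s) (string_funs m lam)"
      by (rule bij_betw_trans[OF bij_betw_twist[OF assms(2)] bij])
    show "linear_on (box_funs r s) ?F"
      using lin linear_on_twist[OF assms(2), of r 0] tw by (simp add: linear_on_def)
    fix w :: "nat \<times> nat \<Rightarrow> 'f" assume w: "w \<in> box_funs r s"
    let ?x = "twist 0 w" and ?y = "twist 0 (shift_sum w)"
    have y: "?y = fg_act ?V g ?x - ?x"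
      using gminus1_twist[OF assms(1,2) w] by (simp add: gminus1_def)
    have "\<phi> (?y + ?x) = \<phi> ?y + \<phi> ?x"
      using lin tw[OF w] tw[OF shift_sum_in_box_funs[OF w]] by (simp add: linear_on_def)
    then have "\<phi> ?y = \<phi> (fg_act ?V g ?x) - \<phi> ?x"
      unfolding y by simp
    also have "\<dots> = gminus1 ?W g (\<phi> ?x)"
      by (simp add: comm[OF tw[OF w]] gminus1_def)
    also have "\<dots> = string_shift (\<phi> ?x)"
      by (rule gminus1_direct_sum[OF _ lam]) (use bij tw[OF w] in \<open>auto simp: bij_betw_def\<close>)
    finally show "?F (shift_sum w) = string_shift (?F w)" by simp
  qed (use assms in auto)
qed

end

hide_const (open) Polynomial.order

theorem proposition7:
  fixes p a q r s n rn sn R S l t k :: nat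
    and G :: "('g, 'm) monoid_scheme" and g :: 'g
    and \<rho> :: "'g \<Rightarrow> (nat \<Rightarrow> 'f::field) \<Rightarrow> nat \<Rightarrow> 'f"
    and lam :: "nat \<Rightarrow> nat"
    and P X \<zeta> :: "'f mat"
    and z y :: "nat \<times> nat \<Rightarrow> 'f"
  assumes "prime p" and "CHAR('f) = p"
    and "0 < a" and "q = p ^ a"
    and "group G" and "g \<in> carrier G" and "generate G {g} = carrier G" and "order G = q"
    and "is_fg_module G (Vmod \<rho> q)"
    and "\<rho> g (bvec 1) = bvec 1"
    and "\<And>i. 1 < i \<Longrightarrow> i \<le> q \<Longrightarrow> \<rho> g (bvec i) = bvec (i - 1) + bvec i"
    and "1 \<le> r" and "r \<le> q" and "1 \<le> s" and "s \<le> q"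
    and "\<And>i. i \<in> {1..min r s} \<Longrightarrow> 0 < lam i \<and> lam i \<le> q"
    and "\<And>i j. 1 \<le> i \<Longrightarrow> i \<le> j \<Longrightarrow> j \<le> min r s \<Longrightarrow> lam j \<le> lam i"
    and "fg_iso G (Vtensor \<rho> r s) (fg_direct_sum {1..min r s} (\<lambda>i. Vmod \<rho> (lam i)))"
    and "p ^ n \<le> max r s" and "max r s < p ^ (n + 1)"
    and "r = rn * p ^ n + R" and "rn < p" and "R < p ^ n"
    and "s = sn * p ^ n + S" and "sn < p" and "S < p ^ n"
    and "l = t * p ^ n + k" and "1 \<le> k" and "k \<le> p ^ n"
    and "max (int r + int s - int p ^ (n + 1)) 0 + 1 \<le> int l" and "l \<le> min r s"
    and "min R S > 0"
    and "R + S + 1 \<le> k"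
    and "int t \<le> min (int rn - 1) (int sn - 1)"
    \<comment> \<open>by the assumptions on \<open>k\<close> and \<open>t\<close>, no subtraction on \<open>nat\<close> below truncates\<close>
    and z: "z = fscale ((- 1) ^ R)
              (\<Sum>i\<in>{0..t}. fscale ((- 1) ^ i * (- 1) ^ (k - S - 1))
                 (vten G g \<rho> n ((i + 1) * p ^ n + R + S + 1 - k) ((t - i + 1) * p ^ n)))"
    \<comment> \<open>rows and columns are numbered from 0, so \<open>P\<close>, \<open>X\<close> and \<open>\<zeta>\<close> are indexed one lower than
        usual; the entries of \<open>P\<close> depend on \<open>j - i\<close> only\<close>
    and P: "P = mat (t + 1) (t + 1) (\<lambda>(i, j).
              fbinom (int rn + int sn - 2 * int t - 2) (int rn - int t + int j - int i - 1))"
    and X: "X = mat (t + 1) 1 (\<lambda>(i, _). (- 1) ^ i)"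
    and \<zeta>: "\<zeta> = the (mat_inverse P) * X"
    and y: "y = fscale ((- 1) ^ (k + R - S - 1))
              (\<Sum>i\<in>{0..t}. fscale (\<zeta> $$ (i, 0))
                 (vten G g \<rho> n ((rn - t + i) * p ^ n + R + S + 1 - k) ((sn - i) * p ^ n)))"
  shows "lam l = (rn + sn - 2 * t - 1) * p ^ n
    \<and> (gminus1 (Vtensor \<rho> r s) g ^^ ((rn + sn - 2 * t - 2) * p ^ n))
        ` Dspace G g \<rho> n r s ((rn + sn - t) * p ^ n + R + S - k)
        \<subseteq> Dspace G g \<rho> n r s ((t + 2) * p ^ n + R + S - k)
    \<and> z \<in> Dspace G g \<rho> n r s ((t + 2) * p ^ n + R + S - k)
    \<and> (gminus1 (Vtensor \<rho> r s) g ^^ (p ^ n - 1)) z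
        = xvec G g \<rho> n ((t + 1) * p ^ n + R + S + 1 - k)
    \<and> invertible_mat P
    \<and> y \<in> Dspace G g \<rho> n r s ((rn + sn - t) * p ^ n + R + S - k)
    \<and> (gminus1 (Vtensor \<rho> r s) g ^^ ((rn + sn - 2 * t - 2) * p ^ n)) y = z"
proof -
  interpret group G by (rule assms(5))
  have "q > 0" using assms(1,4) by (simp add: prime_gt_0_nat)
  then have "finite (carrier G)" using assms(8) by (metis order_gt_0_iff_finite)
  then interpret jordan_action G g \<rho> q
    using assms(5-7,9-11) by unfold_locales
  define Q where "Q = p ^ n"
  have prime: "prime CHAR('f)" and Q: "Q = CHAR('f) ^ n" using assms(1,2) by (simp_all add: Q_def)
  \<comment> \<open>In terms of \<open>A\<close> and \<open>B\<close> no subtraction is left: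
    \<open>rn + sn - 2 * t - 2\<close> is \<open>A + B\<close>, and \<open>rn - t - 1\<close> is
    \<open>A\<close>.\<close>
  obtain A B where A: "rn = A + t + 1" and B: "sn = B + t + 1"
    using assms(34) by (intro that[of "rn - t - 1" "sn - t - 1"]) linarith+
  \<comment> \<open>The first indices of \<open>z\<close> and \<open>y\<close> fall short of
    multiples of \<open>Q\<close> by \<open>c\<close>.\<close>
  define c where "c = k - (R + S + 1)"
  have k: "k = c + R + S + 1" using assms(33) by (simp add: c_def)
  have c: "c < Q" using assms(29) k unfolding Q_def by linarith
  have r: "r = (A + t + 1) * Q + R" and s: "s = (B + t + 1) * Q + S"
    using assms(21,24) by (simp_all only: A B Q_def)
  have pQ: "p ^ (n + 1) = p * Q" by (simp add: Q_def)
  \<comment> \<open>The lower bound on \<open>l\<close> gives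
    \<open>(A + B + 2 * t + 2) * Q < (p + t + 1) * Q\<close>; this keeps the degrees in the window
    lemmas below \<open>p\<close>.\<close>
  have bound: "A + B + t + 1 < p"
  proof -
    have "int r + int s - int p ^ (n + 1) + 1 \<le> int l"
      using assms(30) max.cobounded1[of "int r + int s - int p ^ (n + 1)" 0] by linarith
    then have "int (r + s + 1) \<le> int (p ^ (n + 1) + l)" by simp
    then have "r + s + 1 \<le> p * Q + l" unfolding pQ of_nat_le_iff .
    then have "(A + t + 1) * Q + (B + t + 1) * Q + R + S + 1 \<le> p * Q + t * Q + Q"
      using assms(27,29) unfolding r s Q_def by linarith
    then have "((A + t + 1) + (B + t + 1)) * Q < (p + t + 1) * Q"
      unfolding distrib_right by simp
    then have "(A + t + 1) + (B + t + 1) < p + t + 1" using mult_less_cancel2 by blast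
    then show ?thesis by simp
  qed
  define m where "m = rn + sn - 2 * t - 2"
  have m: "m = A + B" by (simp add: m_def A B)
  have L: "rn + sn - 2 * t - 1 = A + B + 1" by (simp add: A B)

  have P': "P = mat (t + 1) (t + 1) (\<lambda>(i, j). fbinom (int (A + B)) (int A + int j - int i))"
    unfolding P A B by (intro cong_mat) (auto simp: algebra_simps)
  have AB: "A + B + t < CHAR('f)" using bound assms(2) by simp
  have inv: "invertible_mat P" by (rule binomial_toeplitz_inverse(1)[OF AB P'])
  have X': "X \<in> carrier_mat (t + 1) 1" by (simp add: X)
  have \<zeta>': "(\<Sum>j\<le>t. fbinom (int (A + B)) (int A + int j - int i) * \<zeta> $$ (j, 0)) = (- 1) ^ i"
    if "i \<le> t" for i
    using binomial_toeplitz_inverse(2)[OF AB P' that X'] that by (simp add: \<zeta> X)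

  \<comment> \<open>The offset is a parameter because two values are used: the given
    \<open>c\<close> for \<open>z\<close> and \<open>y\<close>, and \<open>0\<close> for the string
    length.\<close>
  define zc where "zc c = grid_fun Q c t 1 (t + 1) (\<lambda>e. (- 1) ^ c * (- 1) ^ e :: 'f)" for c
  define yc where "yc c = grid_fun Q c t (A + 1) (B + t + 1) (\<lambda>e. (- 1) ^ c * \<zeta> $$ (e, 0))" for c
  have le: "(1 + t) * Q \<le> r" "(t + 1) * Q \<le> s" "(A + 1 + t) * Q \<le> r" "(B + t + 1) * Q \<le> s"
    unfolding r s by (rule trans_le_add1, rule mult_le_mono1, simp)+
  have ycb: "yc c \<in> box_funs r s" if "c < Q" for c
    unfolding yc_def by (rule grid_fun_in_box_funs[OF that _ _ le(3,4)]) simp_all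
  have zcb: "zc c \<in> box_funs r s" if "c < Q" for c
    unfolding zc_def by (rule grid_fun_in_box_funs[OF that _ _ le(1,2)]) simp_all
  have Tz: "(shift_sum ^^ (Q - 1)) (zc c) = alt_diag ((t + 1) * Q - c)" if "c < Q" for c
    unfolding zc_def Q by (rule shift_sum_funpow_grid_fun_alternating[OF prime that[unfolded Q]])
  have Ty: "(shift_sum ^^ ((A + B) * Q)) (yc c) = zc c" if "c < Q" for c
  proof -
    let ?g = "\<lambda>e. \<Sum>e'\<le>t. fbinom (int (A + B)) (int A + int e' - int e) * ((- 1) ^ c * \<zeta> $$ (e', 0))"
    have "?g e = (- 1) ^ c * (- 1) ^ e" if "e \<le> t" for e
      using \<zeta>'[OF that] by (simp add: sum_distrib_left mult.left_commute flip: \<zeta>'[OF that])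
    then have "grid_fun Q c t 1 (t + 1) ?g = zc c"
      unfolding zc_def grid_fun_def by (intro ext) (auto intro!: sum.cong)
    then show ?thesis
      unfolding yc_def Q using shift_sum_funpow_grid_fun[OF prime that[unfolded Q], of A B t] by simp
  qed

  have lam_eq: "lam l = (A + B + 1) * Q"
  proof (rule tensor_string_length_eq[OF assms(13,15,18), where l = l])
    have Q0: "0 < Q" using c by simp
    \<comment> \<open>With offset \<open>0\<close> the two steps, of lengths
      \<open>(A + B) * Q\<close> and \<open>Q - 1\<close>, reach
      \<open>alt_diag ((t + 1) * Q)\<close>; as \<open>l \<le> (t + 1) * Q\<close>, row shifts then
      cover all \<open>d \<le> l\<close>.\<close>
    have Lm: "(A + B + 1) * Q - 1 = (Q - 1) + (A + B) * Q" using Q0 by simp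
    have top: "(shift_sum ^^ ((A + B + 1) * Q - 1)) (yc 0) = alt_diag ((t + 1) * Q)"
      unfolding Lm funpow_add o_apply Ty[OF Q0] using Tz[OF Q0] by simp
    have l: "l \<le> (t + 1) * Q" using assms(27,29) by (simp add: Q_def)
    show "\<exists>u\<in>box_funs r s. (shift_sum ^^ ((A + B + 1) * Q - 1)) u = (alt_diag d :: _ \<Rightarrow> 'f)"
      if "1 \<le> d" "d \<le> l" for d
      by (rule alt_diag_image_initial[OF ycb[OF Q0] top]) (use that l in linarith)
    show "(shift_sum ^^ ((A + B + 1) * Q)) u (1, d) = 0"
      if "u \<in> box_funs r s" "shift_sum ((shift_sum ^^ ((A + B + 1) * Q)) u) = 0" "l \<le> d"
      for u :: "nat \<times> nat \<Rightarrow> 'f" and d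
    proof (rule shift_sum_kernel_image_vanishes[where n = n and R = R and S = S, OF prime, folded Q])
      show "A + B + t + 1 < CHAR('f)" using bound assms(2) by simp
      show "u \<in> box_funs ((A + t + 1) * Q + R) ((B + t + 1) * Q + S)"
        using that(1) by (simp only: r s)
      \<comment> \<open>The assumption \<open>R + S + 1 \<le> k\<close> puts \<open>l\<close>, and
        so every \<open>d \<ge> l\<close>, in the range where first-row entries vanish.\<close>
      show "t * Q + R + S + 1 \<le> d" using that(3) assms(27,33) by (simp add: Q_def)
    qed (rule that(2))
    show "1 \<le> (A + B + 1) * Q" using Q0 by simp
  qed (use assms(16,17,27,28,31) in auto)

  let ?V = "Vtensor \<rho> r s"
  define dz dy where "dz = (t + 2) * Q + R + S - k" and "dy = (rn + sn - t) * Q + R + S - k"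
  have dz: "dz + 1 + c = (1 + (t + 1)) * Q"
    using c unfolding dz_def k by simp
  have dy: "dy + 1 + c = (A + 1 + (B + t + 1)) * Q"
    using c unfolding dy_def k A B by simp
  have "dy + 1 + c = dz + (A + B) * Q + 1 + c"
    unfolding dy using dz by (simp add: algebra_simps)
  then have dyz: "dy = dz + (A + B) * Q" by simp
  have idx: "a * p ^ n + R + S + 1 - k = a * Q - c" for a
    by (simp add: k Q_def)
  have z': "z = twist n (zc c)"
  proof -
    \<comment> \<open>The outer sign cancels the \<open>R\<close> in
      \<open>k - S - 1 = c + R\<close>.\<close>
    have sgn: "(- 1 :: 'f) ^ R * ((- 1) ^ i * (- 1) ^ (k - S - 1)) = (- 1) ^ c * (- 1) ^ i" for i
    proof -
      have "k - S - 1 = c + R" by (simp add: k)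
      then have "(- 1 :: 'f) ^ R * ((- 1) ^ i * (- 1) ^ (k - S - 1))
          = (- 1) ^ c * (- 1) ^ i * ((- 1) ^ R * (- 1) ^ R)"
        by (simp only: power_add ac_simps)
      then show ?thesis by (simp flip: power_mult_distrib)
    qed
    have "twist n (zc c) = (\<Sum>i\<in>{0..t}. fscale ((- 1) ^ c * (- 1) ^ i)
        (vten G g \<rho> n ((1 + i) * Q - c) ((t + 1 - i) * Q)))"
      unfolding zc_def by (rule twist_grid_fun[OF assms(15) c _ _ le(1,2)]) simp_all
    also have "\<dots> = z"
      unfolding z fsp.scale_sum_right
    proof (rule sum.cong[OF refl])
      fix i assume "i \<in> {0..t}"
      then have "t - i + 1 = t + 1 - i" by simp
      then show "fscale ((- 1) ^ c * (- 1) ^ i) (vten G g \<rho> n ((1 + i) * Q - c) ((t + 1 - i) * Q))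
          = fscale ((- 1) ^ R) (fscale ((- 1) ^ i * (- 1) ^ (k - S - 1))
              (vten G g \<rho> n ((i + 1) * p ^ n + R + S + 1 - k) ((t - i + 1) * p ^ n)))"
        unfolding fsp.scale_scale sgn idx by (simp add: Q_def)
    qed
    finally show ?thesis by (rule sym)
  qed
  have y': "y = twist n (yc c)"
  proof -
    have sgn: "(- 1 :: 'f) ^ (k + R - S - 1) = (- 1) ^ c"
    proof -
      have "k + R - S - 1 = c + (R + R)" by (simp add: k)
      then show ?thesis by (simp add: power_add flip: power_mult_distrib)
    qed
    have "twist n (yc c) = (\<Sum>i\<in>{0..t}. fscale ((- 1) ^ c * \<zeta> $$ (i, 0))
        (vten G g \<rho> n ((A + 1 + i) * Q - c) ((B + t + 1 - i) * Q)))"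
      unfolding yc_def by (rule twist_grid_fun[OF assms(15) c _ _ le(3,4)]) simp_all
    also have "\<dots> = y"
      unfolding y fsp.scale_sum_right
    proof (rule sum.cong[OF refl])
      fix i assume "i \<in> {0..t}"
      have "rn - t + i = A + 1 + i" "sn - i = B + t + 1 - i" by (simp_all add: A B)
      then show "fscale ((- 1) ^ c * \<zeta> $$ (i, 0)) (vten G g \<rho> n ((A + 1 + i) * Q - c) ((B + t + 1 - i) * Q))
          = fscale ((- 1) ^ (k + R - S - 1)) (fscale (\<zeta> $$ (i, 0))
              (vten G g \<rho> n ((rn - t + i) * p ^ n + R + S + 1 - k) ((sn - i) * p ^ n)))"
        unfolding fsp.scale_scale sgn idx by (simp add: Q_def)
    qed
    finally show ?thesis by (rule sym)
  qed
  note funpow_twist = gminus1_funpow_twist[OF assms(13,15)]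
  have "(gminus1 ?V g ^^ (m * Q)) ` Dspace G g \<rho> n r s dy \<subseteq> Dspace G g \<rho> n r s dz"
    unfolding dyz m by (rule gminus1_funpow_Dspace[OF assms(13,15)])
  moreover have "z \<in> Dspace G g \<rho> n r s dz"
    unfolding z' zc_def by (rule twist_grid_fun_in_Dspace[OF assms(15) c _ _ le(1,2) dz]) simp_all
  moreover have "y \<in> Dspace G g \<rho> n r s dy"
    unfolding y' yc_def by (rule twist_grid_fun_in_Dspace[OF assms(15) c _ _ le(3,4) dy]) simp_all
  moreover have "(gminus1 ?V g ^^ (Q - 1)) z = xvec G g \<rho> n ((t + 1) * Q - c)"
    unfolding z' funpow_twist[OF zcb[OF c]] Tz[OF c]
    by (rule twist_alt_diag) (use le(1,2) assms(15) in auto)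
  moreover have "(gminus1 ?V g ^^ (m * Q)) y = z"
    unfolding y' z' m funpow_twist[OF ycb[OF c]] Ty[OF c] ..
  ultimately show ?thesis
    using lam_eq inv unfolding L idx dz_def dy_def m_def Q_def by blast
qed

end
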